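(* Let $(M,F)$ be an $n$-dimensional Finsler manifold, let $\Gamma$ be the vertical Liouville vector field on $TM^0$, and let $\mathcal{L}_\Gamma'$ be the $G$-orthogonal complement of $\mathcal{L}_\Gamma=\mathrm{span}\{\Gamma\}$ in the vertical bundle $V(TM^0)$. A connection $\nabla^1$ on $\mathcal{L}_\Gamma'$ is basic with respect to the subfoliation $(\mathcal{F}_V,\mathcal{F}_\Gamma)$ if and only if in the induced local charts $(U,(x^i,y^i))$ of $TM^0$ one has $$\nabla^1_\Gamma\frac{\overline\partial}{\overline\partial y^i}=-\frac{\overline\partial}{\overline\partial y^i}\qquad\text{for all } i=1,\dots,n.$$
   Context: $(M,F)$ is a Finsler manifold of dimension $n$; $TM^0=TM\setminus\{\text{zero section}\}$, with induced local coordinates $(x^i,y^i)$, $i=1,\dots,n$, and summation over repeated indices. For a vector bundle $E$, $\Gamma(E)$ denotes its sections. Put $g_{ij}=\frac12\frac{\partial^2F^2}{\partial y^i\partial y^j}$, with inverse $(g^{ij})$. The vertical bundle $V(TM^0)$, locally spanned by $\{\partial/\partial y^i\}$, is tangent to the vertical foliation $\mathcal{F}_V$ (the fibers of $TM^0\to M$). Put $G^i=\frac14g^{ik}\left(\frac{\partial^2F^2}{\partial y^k\partial x^h}y^h-\frac{\partial F^2}{\partial x^k}\right)$, $G_i^j=\frac{\partial G^j}{\partial y^i}$, $\frac{\delta}{\delta x^i}=\frac{\partial}{\partial x^i}-G_i^j\frac{\partial}{\partial y^j}$; these span the horizontal distribution $H(TM^0)$, and $T(TM^0)=H(TM^0)\oplus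 V(TM^0)$. The Riemannian metric $G$ on $TM^0$ is the Sasaki lift: $G(\frac{\delta}{\delta x^i},\frac{\delta}{\delta x^j})=G(\frac{\partial}{\partial y^i},\frac{\partial}{\partial y^j})=g_{ij}$, $G(\frac{\delta}{\delta x^i},\frac{\partial}{\partial y^j})=0$. The vertical Liouville vector field is $\Gamma=y^i\frac{\partial}{\partial y^i}$; $\mathcal{L}_\Gamma$ is the line distribution spanned by $\Gamma$, with foliation $\mathcal{F}_\Gamma$; $\mathcal{L}_\Gamma'=\{X\in V(TM^0): G(X,\Gamma)=0\}$, so $V(TM^0)=\mathcal{L}_\Gamma'\oplus\mathcal{L}_\Gamma$, and $\pi_0:V(TM^0)\to\mathcal{L}_\Gamma'$ is the corresponding projection. The local vector fields $\frac{\overline\partial}{\overline\partial y^k}=\frac{\partial}{\partial y^k}-t_k\Gamma$, $k=1,\dots,n$, with $t_k=\frac1{F^2}y^ig_{ki}=\frac1F\frac{\partial F}{\partial y^k}$, are orthogonal to $\Gamma$ and span $\mathcal{L}_\Gamma'$ (which has rank $n-1$); they satisfy the single linear relation $y^k\frac{\overline\partial}{\overline\partial y^k}=0$. Definition. A connection $\nabla^1$ on $\mathcal{L}_\Gamma'$ is basic with respect to $(\mathcal{F}_V,\mathcal{F}_\Gamma)$ if $\nabla^1_XZ=\pi_0[X,\widetilde Z]$ for all $X\in\Gamma(\mathcal{L}_\Gamma)$, $Z\in\Gamma(\mathcal{L}_\Gamma')$ and all $\widetilde Z\in\Gamma(V(TM^0))$ with $\pi_0(\widetilde Z)=Z$.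 *)

theory Defs
  imports "HOL-Analysis.Analysis"
begin

section \<open>Smooth functions on open subsets of normed spaces\<close>

primrec Ck_on :: "nat \<Rightarrow> 'a::real_normed_vector set \<Rightarrow> ('a \<Rightarrow> 'b::real_normed_vector) \<Rightarrow> bool" where
  "Ck_on 0 S f \<longleftrightarrow> continuous_on S f"
| "Ck_on (Suc k) S f \<longleftrightarrow>
     (\<forall>x\<in>S. f differentiable (at x)) \<and> (\<forall>v. Ck_on k S (\<lambda>x. frechet_derivative f (at x) v))"

definition smooth_on :: "'a::real_normed_vector set \<Rightarrow> ('a \<Rightarrow> 'b::real_normed_vector) \<Rightarrow> bool" where
  "smooth_on S f \<longleftrightarrow> (\<forall>k. Ck_on k S f)"

section \<open>Smooth manifolds\<close>

text \<open>
  A manifold modelled on \<^typ>\<open>'e\<close> is given by an indexed atlas, which need not be maximal (the maximal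
  atlas is the special case where every compatible chart occurs). Keeping the index \<^typ>\<open>'i\<close> abstract
  allows the slit tangent bundle below to be an atlas with the same index set.
\<close>

record ('i, 'm, 'e) atlas =
  points :: "'m set"
  charts :: "'i set"
  chart_dom :: "'i \<Rightarrow> 'm set"
  chart_map :: "'i \<Rightarrow> 'm \<Rightarrow> 'e"

definition chart_inv :: "('i, 'm, 'e) atlas \<Rightarrow> 'i \<Rightarrow> 'e \<Rightarrow> 'm" where
  "chart_inv A c = inv_into (chart_dom A c) (chart_map A c)"

definition transition :: "('i, 'm, 'e) atlas \<Rightarrow> 'i \<Rightarrow> 'i \<Rightarrow> 'e \<Rightarrow> 'e" where
  "transition A c d = chart_map A d \<circ> chart_inv A c"

definition charts_at :: "('i, 'm, 'e) atlas \<Rightarrow> 'm \<Rightarrow> 'i set" where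
  "charts_at A p = {c \<in> charts A. p \<in> chart_dom A c}"

text \<open>An arbitrary chart around a point, for pointwise notions that do not depend on the chart.\<close>

definition chart_at :: "('i, 'm, 'e) atlas \<Rightarrow> 'm \<Rightarrow> 'i" where
  "chart_at A p = (SOME c. c \<in> charts_at A p)"

definition atlas_topology :: "('i, 'm, 'e::euclidean_space) atlas \<Rightarrow> 'm topology" where
  "atlas_topology A = topology_generated_by
     {chart_dom A c \<inter> chart_map A c -` U | c U. c \<in> charts A \<and> open U}"

definition smooth_manifold :: "('i, 'm, 'e::euclidean_space) atlas \<Rightarrow> bool" where
  "smooth_manifold A \<longleftrightarrow>
     points A = (\<Union>c\<in>charts A. chart_dom A c) \<and>
     (\<forall>c\<in>charts A. inj_on (chart_map A c) (chart_dom A c)) \<and>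
     (\<forall>c\<in>charts A. open (chart_map A c ` chart_dom A c)) \<and>
     (\<forall>c\<in>charts A. \<forall>d\<in>charts A.
        open (chart_map A c ` (chart_dom A c \<inter> chart_dom A d)) \<and>
        smooth_on (chart_map A c ` (chart_dom A c \<inter> chart_dom A d)) (transition A c d)) \<and>
     Hausdorff_space (atlas_topology A) \<and>
     second_countable (atlas_topology A)"

definition smooth_fun :: "('i, 'm, 'e::euclidean_space) atlas \<Rightarrow> ('m \<Rightarrow> real) \<Rightarrow> bool" where
  "smooth_fun A f \<longleftrightarrow>
     (\<forall>c\<in>charts A. smooth_on (chart_map A c ` chart_dom A c) (f \<circ> chart_inv A c))"

section \<open>Tangent vectors and vector fields\<close>

text \<open>
  A tangent vector at \<open>p\<close> is the family of its component vectors in the charts around \<open>p\<close>, related by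
  the derivatives of the transition maps. Components at the other indices, and vector fields off the
  manifold, are set to 0, so that equality of functions is equality of vectors and of fields.
\<close>

definition tangent_space :: "('i, 'm, 'e::euclidean_space) atlas \<Rightarrow> 'm \<Rightarrow> ('i \<Rightarrow> 'e) set" where
  "tangent_space A p = {v.
     (\<forall>c. c \<notin> charts_at A p \<longrightarrow> v c = 0) \<and>
     (\<forall>c\<in>charts_at A p. \<forall>d\<in>charts_at A p.
        v d = frechet_derivative (transition A c d) (at (chart_map A c p)) (v c))}"

text \<open>The tangent vector at \<open>p\<close> with components \<open>w\<close> in the chart \<open>c\<close>.\<close>

definition tangent_of :: "('i, 'm, 'e::euclidean_space) atlas \<Rightarrow> 'i \<Rightarrow> 'm \<Rightarrow> 'e \<Rightarrow> 'i \<Rightarrow> 'e" where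
  "tangent_of A c p w = (\<lambda>d. if d \<in> charts_at A p
     then frechet_derivative (transition A c d) (at (chart_map A c p)) w else 0)"

definition field_rep :: "('i, 'm, 'e) atlas \<Rightarrow> 'i \<Rightarrow> ('m \<Rightarrow> 'i \<Rightarrow> 'e) \<Rightarrow> 'e \<Rightarrow> 'e" where
  "field_rep A c X = (\<lambda>u. X (chart_inv A c u) c)"

definition vector_fields :: "('i, 'm, 'e::euclidean_space) atlas \<Rightarrow> ('m \<Rightarrow> 'i \<Rightarrow> 'e) set" where
  "vector_fields A = {X.
     (\<forall>p. p \<notin> points A \<longrightarrow> X p = (\<lambda>_. 0)) \<and>
     (\<forall>p\<in>points A. X p \<in> tangent_space A p) \<and>
     (\<forall>c\<in>charts A. smooth_on (chart_map A c ` chart_dom A c) (field_rep A c X))}"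

definition field_add :: "('m \<Rightarrow> 'i \<Rightarrow> 'e::real_vector) \<Rightarrow> ('m \<Rightarrow> 'i \<Rightarrow> 'e) \<Rightarrow> 'm \<Rightarrow> 'i \<Rightarrow> 'e" where
  "field_add X Y = (\<lambda>p c. X p c + Y p c)"

definition field_scale :: "('m \<Rightarrow> real) \<Rightarrow> ('m \<Rightarrow> 'i \<Rightarrow> 'e::real_vector) \<Rightarrow> 'm \<Rightarrow> 'i \<Rightarrow> 'e" where
  "field_scale f X = (\<lambda>p c. f p *\<^sub>R X p c)"

definition field_apply ::
  "('i, 'm, 'e::euclidean_space) atlas \<Rightarrow> ('m \<Rightarrow> 'i \<Rightarrow> 'e) \<Rightarrow> ('m \<Rightarrow> real) \<Rightarrow> 'm \<Rightarrow> real" where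
  "field_apply A X f p = (let c = chart_at A p in
     frechet_derivative (f \<circ> chart_inv A c) (at (chart_map A c p)) (X p c))"

text \<open>In every chart, \<open>[X, Y]\<^sup>i = X\<^sup>j \<partial>\<^sub>j Y\<^sup>i - Y\<^sup>j \<partial>\<^sub>j X\<^sup>i\<close>.\<close>

definition lie_bracket ::
  "('i, 'm, 'e::euclidean_space) atlas \<Rightarrow> ('m \<Rightarrow> 'i \<Rightarrow> 'e) \<Rightarrow> ('m \<Rightarrow> 'i \<Rightarrow> 'e) \<Rightarrow> 'm \<Rightarrow> 'i \<Rightarrow> 'e" where
  "lie_bracket A X Y p c = (if c \<in> charts_at A p then
       frechet_derivative (field_rep A c Y) (at (chart_map A c p)) (X p c)
     - frechet_derivative (field_rep A c X) (at (chart_map A c p)) (Y p c)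
     else 0)"

section \<open>Sections of subbundles of the tangent bundle, and connections on them\<close>

definition bundle_sections ::
  "('i, 'm, 'e::euclidean_space) atlas \<Rightarrow> ('m \<Rightarrow> ('i \<Rightarrow> 'e) set) \<Rightarrow> ('m \<Rightarrow> 'i \<Rightarrow> 'e) set" where
  "bundle_sections A E = {Z \<in> vector_fields A. \<forall>p\<in>points A. Z p \<in> E p}"

definition connection_on ::
  "('i, 'm, 'e::euclidean_space) atlas \<Rightarrow> ('m \<Rightarrow> ('i \<Rightarrow> 'e) set) \<Rightarrow>
   (('m \<Rightarrow> 'i \<Rightarrow> 'e) \<Rightarrow> ('m \<Rightarrow> 'i \<Rightarrow> 'e) \<Rightarrow> ('m \<Rightarrow> 'i \<Rightarrow> 'e)) \<Rightarrow> bool" where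
  "connection_on A E D \<longleftrightarrow>
     (\<forall>X\<in>vector_fields A. \<forall>Z\<in>bundle_sections A E. D X Z \<in> bundle_sections A E) \<and>
     (\<forall>X\<in>vector_fields A. \<forall>Y\<in>vector_fields A. \<forall>Z\<in>bundle_sections A E.
        D (field_add X Y) Z = field_add (D X Z) (D Y Z)) \<and>
     (\<forall>f X. \<forall>Z\<in>bundle_sections A E. smooth_fun A f \<longrightarrow> X \<in> vector_fields A \<longrightarrow>
        D (field_scale f X) Z = field_scale f (D X Z)) \<and>
     (\<forall>X\<in>vector_fields A. \<forall>Z\<in>bundle_sections A E. \<forall>W\<in>bundle_sections A E.
        D X (field_add Z W) = field_add (D X Z) (D X W)) \<and>
     (\<forall>f X. \<forall>Z\<in>bundle_sections A E. smooth_fun A f \<longrightarrow> X \<in> vector_fields A \<longrightarrow>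
        D X (field_scale f Z) = field_add (field_scale (field_apply A X f) Z) (field_scale f (D X Z)))"

text \<open>
  The value at \<open>p\<close> of the covariant derivative of a local section \<open>s\<close> of \<open>E\<close>, smooth near \<open>p\<close>. As a
  connection is a local operator, it is computed on any global section with the same germ at \<open>p\<close>;
  these exist by multiplying \<open>s\<close> with a cutoff function, and the value does not depend on the choice.
\<close>

definition local_derivative ::
  "('i, 'm, 'e::euclidean_space) atlas \<Rightarrow> ('m \<Rightarrow> ('i \<Rightarrow> 'e) set) \<Rightarrow>
   (('m \<Rightarrow> 'i \<Rightarrow> 'e) \<Rightarrow> ('m \<Rightarrow> 'i \<Rightarrow> 'e) \<Rightarrow> ('m \<Rightarrow> 'i \<Rightarrow> 'e)) \<Rightarrow>
   ('m \<Rightarrow> 'i \<Rightarrow> 'e) \<Rightarrow> ('m \<Rightarrow> 'i \<Rightarrow> 'e) \<Rightarrow> 'm \<Rightarrow> 'i \<Rightarrow> 'e" where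
  "local_derivative A E D X s p =
     D X (SOME Z. Z \<in> bundle_sections A E \<and>
            (\<exists>W. openin (atlas_topology A) W \<and> p \<in> W \<and> (\<forall>q\<in>W. Z q = s q))) p"

section \<open>The slit tangent bundle\<close>

definition tangent_bundle ::
  "('i, 'm, 'e::euclidean_space) atlas \<Rightarrow> ('m \<times> ('i \<Rightarrow> 'e)) set" where
  "tangent_bundle M = (SIGMA p:points M. tangent_space M p)"

text \<open>The charts are the induced coordinates \<open>(x\<^sup>i, y\<^sup>i)\<close>.\<close>

definition slit_tangent_bundle ::
  "('i, 'm, 'e::euclidean_space) atlas \<Rightarrow> ('i, 'm \<times> ('i \<Rightarrow> 'e), 'e \<times> 'e) atlas" where
  "slit_tangent_bundle M = \<lparr>
     points = {(p, v) \<in> tangent_bundle M. v \<noteq> (\<lambda>_. 0)},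
     charts = charts M,
     chart_dom = (\<lambda>c. {(p, v) \<in> tangent_bundle M. v \<noteq> (\<lambda>_. 0) \<and> p \<in> chart_dom M c}),
     chart_map = (\<lambda>c (p, v). (chart_map M c p, v c))\<rparr>"

definition vertical_space ::
  "('i, 'm, 'e::euclidean_space) atlas \<Rightarrow> 'm \<times> ('i \<Rightarrow> 'e) \<Rightarrow> ('i \<Rightarrow> 'e \<times> 'e) set" where
  "vertical_space M q = {X \<in> tangent_space (slit_tangent_bundle M) q.
     \<forall>c\<in>charts_at (slit_tangent_bundle M) q. fst (X c) = 0}"

definition liouville ::
  "('i, 'm, 'e::euclidean_space) atlas \<Rightarrow> 'm \<times> ('i \<Rightarrow> 'e) \<Rightarrow> 'i \<Rightarrow> 'e \<times> 'e" where
  "liouville M q = (\<lambda>c. if q \<in> points (slit_tangent_bundle M) then (0, snd q c) else 0)"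

definition liouville_line ::
  "('i, 'm, 'e::euclidean_space) atlas \<Rightarrow> 'm \<times> ('i \<Rightarrow> 'e) \<Rightarrow> ('i \<Rightarrow> 'e \<times> 'e) set" where
  "liouville_line M q = {\<lambda>c. a *\<^sub>R liouville M q c | a. True}"

section \<open>Finsler manifolds and the Sasaki metric\<close>

text \<open>
  In the following local formulas, \<open>u\<close> is the pair \<open>(x, y)\<close> of coordinates in the induced chart \<open>c\<close>.
\<close>

definition partial_x :: "'n \<Rightarrow> ((real^'n) \<times> (real^'n) \<Rightarrow> real) \<Rightarrow> (real^'n) \<times> (real^'n) \<Rightarrow> real" where
  "partial_x i f u = frechet_derivative f (at u) (axis i 1, 0)"

definition partial_y :: "'n \<Rightarrow> ((real^'n) \<times> (real^'n) \<Rightarrow> real) \<Rightarrow> (real^'n) \<times> (real^'n) \<Rightarrow> real" where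
  "partial_y i f u = frechet_derivative f (at u) (0, axis i 1)"

definition F_squared ::
  "('i, 'm, real^'n) atlas \<Rightarrow> ('m \<times> ('i \<Rightarrow> real^'n) \<Rightarrow> real) \<Rightarrow> 'i \<Rightarrow> (real^'n) \<times> (real^'n) \<Rightarrow> real" where
  "F_squared M F c u = (F (chart_inv (slit_tangent_bundle M) c u))\<^sup>2"

definition fundamental_tensor ::
  "('i, 'm, real^'n) atlas \<Rightarrow> ('m \<times> ('i \<Rightarrow> real^'n) \<Rightarrow> real) \<Rightarrow> 'i \<Rightarrow> (real^'n) \<times> (real^'n) \<Rightarrow> real^'n^'n" where
  "fundamental_tensor M F c u =
     (\<chi> i j. 1/2 * partial_y i (partial_y j (F_squared M F c)) u)"

definition finsler_metric ::
  "('i, 'm, real^'n) atlas \<Rightarrow> ('m \<times> ('i \<Rightarrow> real^'n) \<Rightarrow> real) \<Rightarrow> bool" where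
  "finsler_metric M F \<longleftrightarrow>
     (\<forall>(p, v)\<in>tangent_bundle M. F (p, v) \<ge> 0 \<and> (F (p, v) = 0 \<longleftrightarrow> v = (\<lambda>_. 0))) \<and>
     (\<forall>(p, v)\<in>tangent_bundle M. \<forall>a>0. F (p, \<lambda>c. a *\<^sub>R v c) = a * F (p, v)) \<and>
     smooth_fun (slit_tangent_bundle M) F \<and>
     (\<forall>c\<in>charts M. \<forall>q\<in>chart_dom (slit_tangent_bundle M) c. \<forall>w. w \<noteq> 0 \<longrightarrow>
        w \<bullet> (fundamental_tensor M F c (chart_map (slit_tangent_bundle M) c q) *v w) > 0)"

definition spray_coeff ::
  "('i, 'm, real^'n) atlas \<Rightarrow> ('m \<times> ('i \<Rightarrow> real^'n) \<Rightarrow> real) \<Rightarrow> 'i \<Rightarrow> 'n \<Rightarrow> (real^'n) \<times> (real^'n) \<Rightarrow> real" where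
  "spray_coeff M F c i u = 1/4 * (\<Sum>k\<in>UNIV. matrix_inv (fundamental_tensor M F c u) $ i $ k *
     ((\<Sum>h\<in>UNIV. partial_y k (partial_x h (F_squared M F c)) u * snd u $ h)
      - partial_x k (F_squared M F c) u))"

text \<open>
  Since \<open>\<partial>/\<partial>x\<^sup>i = \<delta>/\<delta>x\<^sup>i + G\<^sub>i\<^sup>j \<partial>/\<partial>y\<^sup>j\<close>, the vector \<open>a\<^sup>i \<partial>/\<partial>x\<^sup>i + b\<^sup>j \<partial>/\<partial>y\<^sup>j\<close>, encoded as \<open>(a, b)\<close>, has the
  components \<open>a\<^sup>i\<close> and \<open>b\<^sup>j + a\<^sup>i G\<^sub>i\<^sup>j\<close> in the frame \<open>\<delta>/\<delta>x\<^sup>i\<close>, \<open>\<partial>/\<partial>y\<^sup>j\<close>. The second one is: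
\<close>

definition vertical_component ::
  "('i, 'm, real^'n) atlas \<Rightarrow> ('m \<times> ('i \<Rightarrow> real^'n) \<Rightarrow> real) \<Rightarrow> 'i \<Rightarrow>
   (real^'n) \<times> (real^'n) \<Rightarrow> (real^'n) \<times> (real^'n) \<Rightarrow> real^'n" where
  "vertical_component M F c u w =
     (\<chi> j. snd w $ j + (\<Sum>i\<in>UNIV. fst w $ i * partial_y i (spray_coeff M F c j) u))"

text \<open>The Sasaki lift. The right-hand side is the same in all charts around \<open>q\<close>.\<close>

definition sasaki_metric ::
  "('i, 'm, real^'n) atlas \<Rightarrow> ('m \<times> ('i \<Rightarrow> real^'n) \<Rightarrow> real) \<Rightarrow> 'm \<times> ('i \<Rightarrow> real^'n) \<Rightarrow>
   ('i \<Rightarrow> (real^'n) \<times> (real^'n)) \<Rightarrow> ('i \<Rightarrow> (real^'n) \<times> (real^'n)) \<Rightarrow> real" where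
  "sasaki_metric M F q X Y =
     (let c = chart_at (slit_tangent_bundle M) q;
          u = chart_map (slit_tangent_bundle M) c q;
          g = fundamental_tensor M F c u
      in fst (X c) \<bullet> (g *v fst (Y c)) +
         vertical_component M F c u (X c) \<bullet> (g *v vertical_component M F c u (Y c)))"

section \<open>The complement of the Liouville direction, and basic connections\<close>

definition liouville_complement ::
  "('i, 'm, real^'n) atlas \<Rightarrow> ('m \<times> ('i \<Rightarrow> real^'n) \<Rightarrow> real) \<Rightarrow> 'm \<times> ('i \<Rightarrow> real^'n) \<Rightarrow>
   ('i \<Rightarrow> (real^'n) \<times> (real^'n)) set" where
  "liouville_complement M F q = {X \<in> vertical_space M q. sasaki_metric M F q X (liouville M q) = 0}"

definition proj_complement ::
  "('i, 'm, real^'n) atlas \<Rightarrow> ('m \<times> ('i \<Rightarrow> real^'n) \<Rightarrow> real) \<Rightarrow> 'm \<times> ('i \<Rightarrow> real^'n) \<Rightarrow>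
   ('i \<Rightarrow> (real^'n) \<times> (real^'n)) \<Rightarrow> 'i \<Rightarrow> (real^'n) \<times> (real^'n)" where
  "proj_complement M F q X = (THE W. W \<in> liouville_complement M F q \<and>
     (\<exists>U\<in>liouville_line M q. X = (\<lambda>c. W c + U c)))"

definition basic_connection ::
  "('i, 'm, real^'n) atlas \<Rightarrow> ('m \<times> ('i \<Rightarrow> real^'n) \<Rightarrow> real) \<Rightarrow>
   (('m \<times> ('i \<Rightarrow> real^'n) \<Rightarrow> 'i \<Rightarrow> (real^'n) \<times> (real^'n)) \<Rightarrow>
    ('m \<times> ('i \<Rightarrow> real^'n) \<Rightarrow> 'i \<Rightarrow> (real^'n) \<times> (real^'n)) \<Rightarrow>
    ('m \<times> ('i \<Rightarrow> real^'n) \<Rightarrow> 'i \<Rightarrow> (real^'n) \<times> (real^'n))) \<Rightarrow> bool" where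
  "basic_connection M F D \<longleftrightarrow>
     (let N = slit_tangent_bundle M in
      \<forall>X\<in>bundle_sections N (liouville_line M).
      \<forall>Z\<in>bundle_sections N (liouville_complement M F).
      \<forall>Z'\<in>bundle_sections N (vertical_space M).
        (\<forall>q\<in>points N. proj_complement M F q (Z' q) = Z q) \<longrightarrow>
        (\<forall>q\<in>points N. D X Z q = proj_complement M F q (lie_bracket N X Z' q)))"

definition t_coeff ::
  "('i, 'm, real^'n) atlas \<Rightarrow> ('m \<times> ('i \<Rightarrow> real^'n) \<Rightarrow> real) \<Rightarrow> 'i \<Rightarrow> 'n \<Rightarrow> 'm \<times> ('i \<Rightarrow> real^'n) \<Rightarrow> real" where
  "t_coeff M F c k q = 1 / (F q)\<^sup>2 * (\<Sum>i\<in>UNIV. snd q c $ i *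
     fundamental_tensor M F c (chart_map (slit_tangent_bundle M) c q) $ k $ i)"

text \<open>The local fields \<open>\<partial>/\<partial>y\<^sup>k - t\<^sub>k \<Gamma>\<close> on the domain of the induced chart \<open>c\<close>.\<close>

definition dbar_y ::
  "('i, 'm, real^'n) atlas \<Rightarrow> ('m \<times> ('i \<Rightarrow> real^'n) \<Rightarrow> real) \<Rightarrow> 'i \<Rightarrow> 'n \<Rightarrow>
   'm \<times> ('i \<Rightarrow> real^'n) \<Rightarrow> 'i \<Rightarrow> (real^'n) \<times> (real^'n)" where
  "dbar_y M F c k q = (\<lambda>d. tangent_of (slit_tangent_bundle M) c q (0, axis k 1) d
     - t_coeff M F c k q *\<^sub>R liouville M q d)"

end

(*
  By Euler's theorem G(X, Gamma) = dF^2(X) / 2 for vertical X, so L' is the kernel of dF^2 on the vertical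
  bundle. The flow of Gamma scales the fibres and multiplies F^2 by a constant, hence [Gamma, Z] is again a
  section of L' whenever Z is. Writing X = a Gamma and Z' = Z + b Gamma, the bracket [X, Z'] equals
  a [Gamma, Z] modulo Gamma, so the connection is basic iff nabla_Gamma Z = [Gamma, Z] for all sections Z of L'.
  Both sides obey the same Leibniz rule in Z, and the bracket of Gamma with the k-th local field is minus that
  field, modulo Gamma and hence exactly; it therefore suffices to compare on these fields, which span L'.
  Cutoff functions turn the local fields and coefficients into global ones.
*)
theory Submission
  imports Defs "HOL-Computational_Algebra.Polynomial"
begin

section \<open>Calculus of smooth functions\<close>

text \<open>Two features of the encoding shape the proof. \<open>D\<close> takes only global
  sections, so a local object must be extended by zero before \<open>D\<close> can see it;
  smoothness of the extension in the other charts rests on the Hausdorff property, which therefore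
  has to be carried over to the slit tangent bundle. And a tangent vector is a family of chart
  components, so [Gamma, Z] must be shown to transform correctly before its membership in L' can be
  asked. The flow settles this: up to a = exp t it is (x, y) |-> (x, a y), so differentiation along
  Gamma is an ordinary derivative at a = 1. Along such a ray the linear conditions defining L', and
  the action of a change of charts on vertical vectors, are constant up to a positive factor, and a
  linear condition with constant coefficients survives differentiation. The local fields are
  linearly dependent (y^k times the k-th field sums to zero), so no dual frame exists; a section of
  L' is instead expanded with its own components on the coordinate fields.\<close>

lemma Ck_on_subset: "Ck_on k T f \<Longrightarrow> S \<subseteq> T \<Longrightarrow> Ck_on k S f"
  by (induction k arbitrary: f) (auto intro: continuous_on_subset)

text \<open>The derivatives in \<open>Ck_on\<close> see a full neighbourhood of each point; openness
  of S is what lets equality on S pass to them.\<close>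

lemma Ck_on_cong:
  assumes "open S" "\<And>x. x \<in> S \<Longrightarrow> f x = g x" "Ck_on k S f"
  shows "Ck_on k S g"
  using assms(2,3)
proof (induction k arbitrary: f g)
  case 0
  then show ?case using continuous_on_cong by fastforce
next
  case (Suc k)
  have d: "f differentiable (at x)" if "x \<in> S" for x using Suc.prems(2) that by simp
  have "frechet_derivative f (at x) = frechet_derivative g (at x)" if "x \<in> S" for x
    using frechet_derivative_transform_within_open[OF d[OF that] assms(1) that Suc.prems(1)] .
  then have "Ck_on k S (\<lambda>x. frechet_derivative g (at x) v)" for v
    using Suc.IH[of "\<lambda>x. frechet_derivative f (at x) v" "\<lambda>x. frechet_derivative g (at x) v"] Suc.prems(2)
    by simp
  moreover have "g differentiable (at x)" if "x \<in> S" for x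
    using d[OF that] Suc.prems(1) has_derivative_transform_within_open[OF _ assms(1) that]
    unfolding differentiable_def by blast
  ultimately show ?case by simp
qed

text \<open>Gives the induction steps below their shape: a rule of calculus supplies some derivative
  \<open>f'\<close>, and only its values in fixed directions have to be of order k.\<close>

lemma Ck_on_SucI:
  assumes "open S" "\<And>x. x \<in> S \<Longrightarrow> (f has_derivative f' x) (at x)" "\<And>v. Ck_on k S (\<lambda>x. f' x v)"
  shows "Ck_on (Suc k) S f"
proof -
  have "f' x = frechet_derivative f (at x)" if "x \<in> S" for x
    using frechet_derivative_at[OF assms(2)[OF that]] .
  then have "Ck_on k S (\<lambda>x. frechet_derivative f (at x) v)" for v
    using Ck_on_cong[OF assms(1) _ assms(3)] by simp
  then show ?thesis using assms(2) by (auto simp: differentiable_def)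
qed

lemma Ck_on_local:
  assumes "\<And>x. x \<in> S \<Longrightarrow> \<exists>T. open T \<and> x \<in> T \<and> Ck_on k T f"
  shows "Ck_on k S f"
  using assms
proof (induction k arbitrary: f)
  case 0
  have "isCont f x" if x: "x \<in> S" for x
  proof -
    obtain T where "open T" "x \<in> T" "continuous_on T f" using 0[OF x] by auto
    then show ?thesis by (simp add: continuous_on_eq_continuous_at)
  qed
  then show ?case by (simp add: continuous_at_imp_continuous_on)
next
  case (Suc k)
  have "f differentiable at x" if "x \<in> S" for x using Suc.prems[OF that] by auto
  moreover have "Ck_on k S (\<lambda>x. frechet_derivative f (at x) v)" for v
  proof (rule Suc.IH)
    fix x assume "x \<in> S"
    from Suc.prems[OF this]
    show "\<exists>T. open T \<and> x \<in> T \<and> Ck_on k T (\<lambda>x. frechet_derivative f (at x) v)" by auto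
  qed
  ultimately show ?case by simp
qed

text \<open>The recursion for \<open>Ck_on (Suc k)\<close> does not mention lower orders of f
  itself. They are recovered here because product and chain rules need the undifferentiated factors
  at order k.\<close>

lemma Ck_on_SucD: "Ck_on (Suc k) S f \<Longrightarrow> Ck_on k S f"
proof (induction k arbitrary: f)
  case 0
  then show ?case
    by (auto intro!: continuous_at_imp_continuous_on differentiable_imp_continuous_within)
next
  case (Suc k)
  have "\<forall>x\<in>S. f differentiable at x" "\<And>v. Ck_on (Suc k) S (\<lambda>x. frechet_derivative f (at x) v)"
    using iffD1[OF Ck_on.simps(2) Suc.prems] by blast+
  then show ?case using Suc.IH Ck_on.simps(2) by blast
qed

lemma Ck_on_has_derivative:
  "Ck_on (Suc k) S f \<Longrightarrow> x \<in> S \<Longrightarrow> (f has_derivative frechet_derivative f (at x)) (at x)"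
  by (simp add: frechet_derivative_works)

lemma Ck_on_const: "Ck_on k S (\<lambda>x. c)"
  by (induction k arbitrary: c) simp_all

lemma Ck_on_bounded_linear:
  assumes "open S" "bounded_linear L" "Ck_on k S f"
  shows "Ck_on k S (\<lambda>x. L (f x))"
  using assms(3)
proof (induction k arbitrary: f)
  case 0
  then show ?case using bounded_linear.continuous_on[OF assms(2)] by simp
next
  case (Suc k)
  show ?case
    by (rule Ck_on_SucI[OF assms(1) bounded_linear.has_derivative[OF assms(2) Ck_on_has_derivative[OF Suc.prems]]])
      (use Suc in auto)
qed

lemma Ck_on_ident: "Ck_on k S (\<lambda>x. x)"
  by (cases k) (auto intro: continuous_on_id simp: Ck_on_const)

lemma Ck_on_add:
  assumes "open S" "Ck_on k S f" "Ck_on k S g"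
  shows "Ck_on k S (\<lambda>x. f x + g x)"
  using assms(2,3)
proof (induction k arbitrary: f g)
  case 0
  then show ?case by (auto intro: continuous_intros)
next
  case (Suc k)
  show ?case
    by (rule Ck_on_SucI[OF assms(1) has_derivative_add[OF Ck_on_has_derivative[OF Suc.prems(1)]
            Ck_on_has_derivative[OF Suc.prems(2)]]])
      (use Suc in auto)
qed

lemma Ck_on_sum:
  assumes "open S" "\<And>i. i \<in> I \<Longrightarrow> Ck_on k S (f i)"
  shows "Ck_on k S (\<lambda>x. \<Sum>i\<in>I. f i x)"
  using assms(2) by (induction I rule: infinite_finite_induct) (auto intro: Ck_on_const Ck_on_add assms(1))

lemma Ck_on_bounded_bilinear:
  assumes "open S" "bounded_bilinear B" "Ck_on k S f" "Ck_on k S g"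
  shows "Ck_on k S (\<lambda>x. B (f x) (g x))"
  using assms(3,4)
proof (induction k arbitrary: f g)
  case 0
  then show ?case using bounded_bilinear.continuous_on[OF assms(2)] by simp
next
  case (Suc k)
  show ?case
    by (rule Ck_on_SucI[OF assms(1) bounded_bilinear.FDERIV[OF assms(2) Ck_on_has_derivative[OF Suc.prems(1)]
            Ck_on_has_derivative[OF Suc.prems(2)]]])
      (use Suc Ck_on_SucD[OF Suc.prems(1)] Ck_on_SucD[OF Suc.prems(2)] in \<open>auto intro!: Ck_on_add assms(1)\<close>)
qed

text \<open>\<open>Ck_on\<close> controls derivatives in fixed directions only. A direction that
  moves with x is expanded in the basis, which leaves finitely many fixed ones.\<close>

lemma Ck_on_frechet_derivative_apply:
  fixes g :: "'a::euclidean_space \<Rightarrow> 'b::real_normed_vector"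
  assumes "open S" "\<And>x. x \<in> S \<Longrightarrow> g differentiable at (f x)"
    and "\<And>b. b \<in> Basis \<Longrightarrow> Ck_on k S (\<lambda>x. frechet_derivative g (at (f x)) b)" "Ck_on k S h"
  shows "Ck_on k S (\<lambda>x. frechet_derivative g (at (f x)) (h x))"
proof -
  have "Ck_on k S (\<lambda>x. \<Sum>b\<in>Basis. (h x \<bullet> b) *\<^sub>R frechet_derivative g (at (f x)) b)"
    by (intro Ck_on_sum assms(1) Ck_on_bounded_bilinear[OF _ bounded_bilinear_scaleR] assms(3)
        Ck_on_bounded_linear[OF assms(1) bounded_linear_inner_left assms(4)])
  moreover have "(\<Sum>b\<in>Basis. (h x \<bullet> b) *\<^sub>R frechet_derivative g (at (f x)) b)
      = frechet_derivative g (at (f x)) (h x)" if "x \<in> S" for x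
    using linear_sum[OF linear_frechet_derivative[OF assms(2)[OF that]], of "\<lambda>b. (h x \<bullet> b) *\<^sub>R b" Basis]
    by (simp add: euclidean_representation linear_cmul[OF linear_frechet_derivative[OF assms(2)[OF that]]])
  ultimately show ?thesis by (rule Ck_on_cong[OF assms(1), rotated])
qed

text \<open>The chain rule yields the derivative of g in a moving direction. The induction
  hypothesis is applied to the directional derivatives of g along basis vectors, hence the
  generalisation over g.\<close>

lemma Ck_on_compose:
  fixes f :: "'a::real_normed_vector \<Rightarrow> 'b::euclidean_space"
  assumes "open S" "open T" "f ` S \<subseteq> T" "Ck_on k T g" "Ck_on k S f"
  shows "Ck_on k S (\<lambda>x. g (f x))"
  using assms(4,5)
proof (induction k arbitrary: g)
  case 0
  then show ?case using assms(3) by (auto intro: continuous_on_compose2)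
next
  case (Suc k)
  have f: "Ck_on k S f" using Suc.prems(2) Ck_on_SucD by blast
  have 1: "((\<lambda>x. g (f x)) has_derivative
      (\<lambda>v. frechet_derivative g (at (f x)) (frechet_derivative f (at x) v))) (at x)" if "x \<in> S" for x
    using has_derivative_compose[OF Ck_on_has_derivative[OF Suc.prems(2) that]
        Ck_on_has_derivative[OF Suc.prems(1), of "f x"]] assms(3) that by auto
  show ?case
  proof (rule Ck_on_SucI[OF assms(1) 1])
    fix v
    show "Ck_on k S (\<lambda>x. frechet_derivative g (at (f x)) (frechet_derivative f (at x) v))"
    proof (rule Ck_on_frechet_derivative_apply[OF assms(1)])
      show "g differentiable at (f x)" if "x \<in> S" for x using Suc.prems(1) assms(3) that by auto
      show "Ck_on k S (\<lambda>x. frechet_derivative g (at (f x)) b)" for b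
        using Suc.IH[of "\<lambda>y. frechet_derivative g (at y) b"] Suc.prems(1) f by simp
      show "Ck_on k S (\<lambda>x. frechet_derivative f (at x) v)" using Suc.prems(2) by simp
    qed
  qed
qed

text \<open>The derivative of 1/f consists of f' and two factors 1/f, which the induction hypothesis
  covers one order lower.\<close>

lemma Ck_on_inverse:
  fixes f :: "'a::real_normed_vector \<Rightarrow> real"
  assumes "open S" "Ck_on k S f" "\<And>x. x \<in> S \<Longrightarrow> f x \<noteq> 0"
  shows "Ck_on k S (\<lambda>x. inverse (f x))"
  using assms(2)
proof (induction k)
  case 0
  then show ?case using assms(3) by (auto intro: continuous_on_inverse)
next
  case (Suc k)
  have m: "Ck_on k S (\<lambda>x. a x * b x)" if "Ck_on k S a" "Ck_on k S b" for a b :: "'a \<Rightarrow> real"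
    by (rule Ck_on_bounded_bilinear[OF assms(1) bounded_bilinear_mult that])
  have i: "Ck_on k S (\<lambda>x. inverse (f x))" using Suc Ck_on_SucD by blast
  show ?case
    by (rule Ck_on_SucI[OF assms(1) Deriv.has_derivative_inverse[OF assms(3) Ck_on_has_derivative[OF Suc.prems]]])
      (use Suc i in \<open>auto intro!: m Ck_on_bounded_linear[OF assms(1) bounded_linear_minus[OF bounded_linear_ident]]\<close>)
qed

section \<open>Closure properties of smooth functions\<close>

lemma smooth_on_subset: "smooth_on T f \<Longrightarrow> S \<subseteq> T \<Longrightarrow> smooth_on S f"
  using Ck_on_subset unfolding smooth_on_def by blast

lemma smooth_on_cong:
  "smooth_on S f \<Longrightarrow> open S \<Longrightarrow> (\<And>x. x \<in> S \<Longrightarrow> f x = g x) \<Longrightarrow> smooth_on S g"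
  unfolding smooth_on_def using Ck_on_cong by blast

lemma smooth_on_local:
  assumes "\<And>x. x \<in> S \<Longrightarrow> \<exists>T. open T \<and> x \<in> T \<and> smooth_on T f"
  shows "smooth_on S f"
  unfolding smooth_on_def
proof (intro allI Ck_on_local)
  fix k x assume "x \<in> S"
  from assms[OF this] show "\<exists>T. open T \<and> x \<in> T \<and> Ck_on k T f" unfolding smooth_on_def by blast
qed

lemma smooth_on_differentiable: "smooth_on S f \<Longrightarrow> x \<in> S \<Longrightarrow> f differentiable at x"
  unfolding smooth_on_def by (auto dest!: spec[of _ "Suc 0"])

lemma smooth_on_has_derivative:
  "smooth_on S f \<Longrightarrow> x \<in> S \<Longrightarrow> (f has_derivative frechet_derivative f (at x)) (at x)"
  using smooth_on_differentiable frechet_derivative_works by blast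

lemma smooth_on_linear_derivative:
  "smooth_on S f \<Longrightarrow> x \<in> S \<Longrightarrow> linear (frechet_derivative f (at x))"
  using smooth_on_differentiable linear_frechet_derivative by blast

lemma smooth_on_frechet_derivative:
  "smooth_on S f \<Longrightarrow> smooth_on S (\<lambda>x. frechet_derivative f (at x) v)"
  unfolding smooth_on_def
proof
  fix k assume "\<forall>k. Ck_on k S f"
  then have "Ck_on (Suc k) S f" by blast
  then show "Ck_on k S (\<lambda>x. frechet_derivative f (at x) v)" by simp
qed

lemma smooth_on_imp_continuous_on: "smooth_on S f \<Longrightarrow> continuous_on S f"
  unfolding smooth_on_def by (auto dest!: spec[of _ "0"])

lemma smooth_on_const: "smooth_on S (\<lambda>x. c)"
  by (simp add: smooth_on_def Ck_on_const)

lemma smooth_on_ident: "smooth_on S (\<lambda>x. x)"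
  by (simp add: smooth_on_def Ck_on_ident)

lemma smooth_on_bounded_linear:
  "open S \<Longrightarrow> bounded_linear L \<Longrightarrow> smooth_on S f \<Longrightarrow> smooth_on S (\<lambda>x. L (f x))"
  by (simp add: smooth_on_def Ck_on_bounded_linear)

lemma smooth_on_bounded_bilinear:
  "open S \<Longrightarrow> bounded_bilinear B \<Longrightarrow> smooth_on S f \<Longrightarrow> smooth_on S g \<Longrightarrow> smooth_on S (\<lambda>x. B (f x) (g x))"
  by (simp add: smooth_on_def Ck_on_bounded_bilinear)

lemma smooth_on_add:
  "open S \<Longrightarrow> smooth_on S f \<Longrightarrow> smooth_on S g \<Longrightarrow> smooth_on S (\<lambda>x. f x + g x)"
  by (simp add: smooth_on_def Ck_on_add)

lemma smooth_on_minus: "open S \<Longrightarrow> smooth_on S f \<Longrightarrow> smooth_on S (\<lambda>x. - f x)"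
  using smooth_on_bounded_linear[OF _ bounded_linear_minus[OF bounded_linear_ident]] .

lemma smooth_on_diff:
  "open S \<Longrightarrow> smooth_on S f \<Longrightarrow> smooth_on S g \<Longrightarrow> smooth_on S (\<lambda>x. f x - g x)"
  using smooth_on_add[of S f "\<lambda>x. - g x"] smooth_on_minus by auto

lemma smooth_on_mult:
  fixes f g :: "_ \<Rightarrow> 'b::real_normed_algebra"
  shows "open S \<Longrightarrow> smooth_on S f \<Longrightarrow> smooth_on S g \<Longrightarrow> smooth_on S (\<lambda>x. f x * g x)"
  by (rule smooth_on_bounded_bilinear[OF _ bounded_bilinear_mult])

lemma smooth_on_scaleR:
  "open S \<Longrightarrow> smooth_on S f \<Longrightarrow> smooth_on S g \<Longrightarrow> smooth_on S (\<lambda>x. f x *\<^sub>R g x)"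
  by (rule smooth_on_bounded_bilinear[OF _ bounded_bilinear_scaleR])

lemma smooth_on_inner:
  "open S \<Longrightarrow> smooth_on S f \<Longrightarrow> smooth_on S g \<Longrightarrow> smooth_on S (\<lambda>x. f x \<bullet> g x)"
  by (rule smooth_on_bounded_bilinear[OF _ bounded_bilinear_inner])

lemma smooth_on_inverse:
  fixes f :: "'a::real_normed_vector \<Rightarrow> real"
  shows "open S \<Longrightarrow> smooth_on S f \<Longrightarrow> (\<And>x. x \<in> S \<Longrightarrow> f x \<noteq> 0) \<Longrightarrow> smooth_on S (\<lambda>x. inverse (f x))"
  by (simp add: smooth_on_def Ck_on_inverse)

lemma smooth_on_divide:
  fixes f :: "'a::real_normed_vector \<Rightarrow> real"
  shows "open S \<Longrightarrow> smooth_on S f \<Longrightarrow> smooth_on S g \<Longrightarrow> (\<And>x. x \<in> S \<Longrightarrow> g x \<noteq> 0) \<Longrightarrow>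
    smooth_on S (\<lambda>x. f x / g x)"
  unfolding divide_inverse by (intro smooth_on_mult smooth_on_inverse)

lemma smooth_on_fst: "open S \<Longrightarrow> smooth_on S f \<Longrightarrow> smooth_on S (\<lambda>x. fst (f x))"
  by (rule smooth_on_bounded_linear[OF _ bounded_linear_fst])

lemma smooth_on_snd: "open S \<Longrightarrow> smooth_on S f \<Longrightarrow> smooth_on S (\<lambda>x. snd (f x))"
  by (rule smooth_on_bounded_linear[OF _ bounded_linear_snd])

lemma smooth_on_Pair:
  assumes "open S" "smooth_on S f" "smooth_on S g"
  shows "smooth_on S (\<lambda>x. (f x, g x))"
proof -
  have "bounded_linear (\<lambda>x. (x, 0))" "bounded_linear (\<lambda>x. (0, x))"
    by (intro bounded_linear_Pair bounded_linear_ident bounded_linear_zero)+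
  from smooth_on_add[OF assms(1) smooth_on_bounded_linear[OF assms(1) this(1) assms(2)]
      smooth_on_bounded_linear[OF assms(1) this(2) assms(3)]]
  show ?thesis by simp
qed

lemma smooth_on_compose:
  fixes f :: "'a::real_normed_vector \<Rightarrow> 'b::euclidean_space"
  shows "open S \<Longrightarrow> open T \<Longrightarrow> f ` S \<subseteq> T \<Longrightarrow> smooth_on T g \<Longrightarrow> smooth_on S f \<Longrightarrow> smooth_on S (\<lambda>x. g (f x))"
  unfolding smooth_on_def using Ck_on_compose[of S T f] by blast

text \<open>Changes of chart for vectors have this form: the derivative of a transition map at a
  moving point, applied to moving components.\<close>

lemma smooth_on_frechet_derivative_apply:
  fixes f :: "'a::real_normed_vector \<Rightarrow> 'b::euclidean_space"
  assumes "open S" "open T" "f ` S \<subseteq> T" "smooth_on T g" "smooth_on S f" "smooth_on S h"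
  shows "smooth_on S (\<lambda>x. frechet_derivative g (at (f x)) (h x))"
proof -
  have "smooth_on S (\<lambda>x. frechet_derivative g (at (f x)) b)" for b
    by (rule smooth_on_compose[OF assms(1-3) smooth_on_frechet_derivative[OF assms(4)] assms(5)])
  moreover have "g differentiable at (f x)" if "x \<in> S" for x
    using smooth_on_differentiable[OF assms(4)] assms(3) that by blast
  ultimately show ?thesis
    using assms(6) Ck_on_frechet_derivative_apply[OF assms(1)] unfolding smooth_on_def by blast
qed

section \<open>Bump functions\<close>

text \<open>With polynomial factors in \<open>1/t\<close> the family is closed under differentiation, so that smoothness follows
  by induction on the order.\<close>

definition flat_exp :: "real poly \<Rightarrow> real \<Rightarrow> real" where
  "flat_exp p t = (if t > 0 then poly p (inverse t) * exp (- inverse t) else 0)"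

lemma tendsto_poly_mult_exp_minus: "((\<lambda>s. poly p s * exp (- s)) \<longlongrightarrow> (0::real)) at_top"
proof -
  have "((\<lambda>s. \<Sum>i\<le>degree p. coeff p i * (s ^ i / exp s)) \<longlongrightarrow> (0::real)) at_top"
    by (intro tendsto_null_sum tendsto_mult_right_zero tendsto_power_div_exp_0)
  then show ?thesis
    by (simp add: poly_altdef exp_minus sum_distrib_right divide_inverse mult.assoc)
qed

text \<open>For t > 0 the derivative of p(1/t) exp(-1/t) is t^-2 (p - p')(1/t) exp(-1/t), and t^-2
  is \<open>monom 1 2\<close> evaluated at 1/t. Only t = 0 needs a limit.\<close>

lemma flat_exp_has_derivative:
  "(flat_exp p has_real_derivative flat_exp (monom 1 2 * (p - pderiv p)) t) (at t)"
proof -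
  consider "t > 0" | "t < 0" | "t = 0" by linarith
  then show ?thesis
  proof cases
    case 1
    have "((\<lambda>t. poly p (inverse t) * exp (- inverse t)) has_real_derivative
        flat_exp (monom 1 2 * (p - pderiv p)) t) (at t)"
      using 1
      by (auto intro!: derivative_eq_intros DERIV_chain2[of "poly p"] simp: flat_exp_def poly_monom
          algebra_simps power2_eq_square)
    then show ?thesis
      by (rule has_field_derivative_transform_within_open[of _ _ _ "{0<..}"]) (use 1 in \<open>auto simp: flat_exp_def\<close>)
  next
    case 2
    have "((\<lambda>t. 0) has_real_derivative flat_exp (monom 1 2 * (p - pderiv p)) t) (at t)"
      using 2 by (simp add: flat_exp_def)
    then show ?thesis
      by (rule has_field_derivative_transform_within_open[of _ _ _ "{..<0}"]) (use 2 in \<open>auto simp: flat_exp_def\<close>)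
  next
    case 3
    have "((\<lambda>h. flat_exp p h / h) \<longlongrightarrow> 0) (at 0)"
    proof (rule filterlim_split_at)
      show "((\<lambda>h. flat_exp p h / h) \<longlongrightarrow> 0) (at_left 0)"
        by (rule tendsto_eventually) (auto simp: flat_exp_def eventually_at_filter)
      \<comment> \<open>Here h is the reciprocal of the original argument. The difference quotient
        becomes h p(h) exp(-h), and \<open>pCons 0 p\<close> is the polynomial x p(x).\<close>
      have "\<forall>\<^sub>F h in at_top. poly (pCons 0 p) h * exp (- h) = flat_exp p (inverse h) / inverse h"
        using eventually_gt_at_top[of 0] by eventually_elim (simp add: flat_exp_def divide_inverse)
      from Lim_transform_eventually[OF tendsto_poly_mult_exp_minus this]
      show "((\<lambda>h. flat_exp p h / h) \<longlongrightarrow> 0) (at_right 0)"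
        by (simp add: filterlim_at_right_to_top)
    qed
    then show ?thesis using 3 by (simp add: DERIV_def flat_exp_def)
  qed
qed

lemma smooth_on_flat_exp: "smooth_on UNIV (flat_exp p)"
  unfolding smooth_on_def
proof
  fix k show "Ck_on k UNIV (flat_exp p)"
  proof (induction k arbitrary: p)
    case 0
    show ?case
      by (auto intro!: continuous_at_imp_continuous_on DERIV_isCont flat_exp_has_derivative)
  next
    case (Suc k)
    show ?case
      by (rule Ck_on_SucI[OF open_UNIV flat_exp_has_derivative[unfolded has_field_derivative_def]])
        (auto intro: Ck_on_bounded_linear[OF _ bounded_linear_mult_left] Suc)
  qed
qed

lemma smooth_step_exists:
  "\<exists>s::real \<Rightarrow> real. smooth_on UNIV s \<and> (\<forall>t\<le>0. s t = 0) \<and> (\<forall>t\<ge>1. s t = 1)"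
proof -
  let ?e = "flat_exp 1"
  let ?s = "\<lambda>t. ?e t / (?e t + ?e (1 - t))"
  have pos: "?e t > 0" if "t > 0" for t using that by (simp add: flat_exp_def)
  have nn: "?e t \<ge> 0" for t by (simp add: flat_exp_def)
  \<comment> \<open>At least one of t and 1 - t is positive.\<close>
  have "?e t + ?e (1 - t) \<noteq> 0" for t
    using pos[of t] pos[of "1 - t"] nn[of t] nn[of "1 - t"] by (cases "t > 0") auto
  then have "smooth_on UNIV ?s"
    by (intro smooth_on_divide smooth_on_add smooth_on_flat_exp open_UNIV
        smooth_on_compose[OF open_UNIV open_UNIV _ smooth_on_flat_exp, of "\<lambda>t. 1 - t"]
        smooth_on_diff smooth_on_const smooth_on_ident) auto
  moreover have "?s t = 0" if "t \<le> 0" for t using that by (simp add: flat_exp_def)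
  moreover have "?s t = 1" if "t \<ge> 1" for t using that pos[of t] by (simp add: flat_exp_def)
  ultimately show ?thesis by blast
qed

lemma smooth_bump_exists:
  fixes a :: "'a::euclidean_space"
  assumes "open U" "a \<in> U"
  obtains h :: "'a \<Rightarrow> real" and K V where "smooth_on UNIV h" "compact K" "K \<subseteq> U"
    "\<And>x. x \<notin> K \<Longrightarrow> h x = 0" "open V" "a \<in> V" "V \<subseteq> K" "\<And>x. x \<in> V \<Longrightarrow> h x = 1"
proof -
  obtain e where e: "e > 0" "cball a e \<subseteq> U" using assms open_contains_cball by blast
  obtain s :: "real \<Rightarrow> real" where s: "smooth_on UNIV s" "\<And>t. t \<le> 0 \<Longrightarrow> s t = 0" "\<And>t. t \<ge> 1 \<Longrightarrow> s t = 1"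
    using smooth_step_exists by blast
  \<comment> \<open>The squared distance keeps h smooth at the centre. The argument of s is at least
    1 up to distance e/2, and it is -2 at distance e, hence negative from there on.\<close>
  define h where "h x = s (2 - (2 / e)\<^sup>2 * ((x - a) \<bullet> (x - a)))" for x
  have dist: "(x - a) \<bullet> (x - a) = (dist a x)\<^sup>2" for x
    by (simp add: dist_norm power2_norm_eq_inner norm_minus_commute[of a])
  show thesis
  proof (rule that[of h "cball a e" "ball a (e / 2)"])
    show "smooth_on UNIV h" unfolding h_def
      by (intro smooth_on_compose[OF open_UNIV open_UNIV _ s(1), of "\<lambda>x. 2 - (2 / e)\<^sup>2 * ((x - a) \<bullet> (x - a))"]
          smooth_on_diff smooth_on_mult smooth_on_inner smooth_on_const smooth_on_ident open_UNIV) auto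
    show "h x = 0" if "x \<notin> cball a e" for x
    proof -
      have "(2 / e * e)\<^sup>2 \<le> (2 / e * dist a x)\<^sup>2"
        using that e by (intro power_mono mult_left_mono) auto
      then show ?thesis unfolding h_def dist using e by (intro s(2)) (simp add: power_mult_distrib power_divide)
    qed
    show "h x = 1" if "x \<in> ball a (e / 2)" for x
    proof -
      have "(2 / e * dist a x)\<^sup>2 \<le> (2 / e * (e / 2))\<^sup>2"
        using that e by (intro power_mono mult_left_mono) auto
      then show ?thesis unfolding h_def dist using e by (intro s(3)) (simp add: power_mult_distrib power_divide)
    qed
  qed (use e in auto)
qed

section \<open>Atlases with smooth transition maps\<close>

lemma openin_chart_preimage:
  assumes "c \<in> charts A" "open U"
  shows "openin (atlas_topology A) (chart_dom A c \<inter> chart_map A c -` U)"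
  unfolding atlas_topology_def using assms by (intro topology_generated_by_Basis) blast

lemma topspace_atlas_topology: "topspace (atlas_topology A) = (\<Union>c\<in>charts A. chart_dom A c)"
  using openin_subset[OF openin_chart_preimage[OF _ open_UNIV]]
  by (auto simp: atlas_topology_def)

text \<open>Interpreted twice below, for the base manifold and for its slit tangent bundle.\<close>

locale smooth_atlas =
  fixes A :: "('i, 'm, 'e::euclidean_space) atlas"
  assumes points_eq: "points A = (\<Union>c\<in>charts A. chart_dom A c)"
    and inj_chart: "c \<in> charts A \<Longrightarrow> inj_on (chart_map A c) (chart_dom A c)"
    and open_image: "c \<in> charts A \<Longrightarrow> open (chart_map A c ` chart_dom A c)"
    and open_overlap: "c \<in> charts A \<Longrightarrow> d \<in> charts A \<Longrightarrow>
      open (chart_map A c ` (chart_dom A c \<inter> chart_dom A d))"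
    and smooth_transition: "c \<in> charts A \<Longrightarrow> d \<in> charts A \<Longrightarrow>
      smooth_on (chart_map A c ` (chart_dom A c \<inter> chart_dom A d)) (transition A c d)"
    and Hausdorff: "Hausdorff_space (atlas_topology A)"

lemma smooth_manifold_imp_smooth_atlas: "smooth_manifold A \<Longrightarrow> smooth_atlas A"
  by (auto simp: smooth_manifold_def smooth_atlas_def)

context smooth_atlas
begin

section \<open>Charts, transition maps and the derivatives of transition maps\<close>

abbreviation "cdom \<equiv> chart_dom A"
abbreviation "img c \<equiv> chart_map A c ` chart_dom A c"
abbreviation "overlap c d \<equiv> chart_map A c ` (chart_dom A c \<inter> chart_dom A d)"
abbreviation "D_transition c d p \<equiv> frechet_derivative (transition A c d) (at (chart_map A c p))"

lemma charts_at_iff: "c \<in> charts_at A p \<longleftrightarrow> c \<in> charts A \<and> p \<in> cdom c"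
  by (simp add: charts_at_def)

lemma mem_points: "c \<in> charts A \<Longrightarrow> p \<in> cdom c \<Longrightarrow> p \<in> points A"
  by (auto simp: points_eq)

lemma chart_at_mem: "p \<in> points A \<Longrightarrow> chart_at A p \<in> charts_at A p"
  unfolding chart_at_def by (rule someI_ex) (auto simp: points_eq charts_at_def)

lemma chart_inv_map: "c \<in> charts A \<Longrightarrow> p \<in> cdom c \<Longrightarrow> chart_inv A c (chart_map A c p) = p"
  by (simp add: chart_inv_def inv_into_f_f inj_chart)

lemma chart_inv_mem: "u \<in> img c \<Longrightarrow> chart_inv A c u \<in> cdom c"
  by (simp add: chart_inv_def inv_into_into)

lemma chart_map_inv: "u \<in> img c \<Longrightarrow> chart_map A c (chart_inv A c u) = u"
  by (simp add: chart_inv_def f_inv_into_f)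

lemma overlap_iff:
  "c \<in> charts A \<Longrightarrow> u \<in> overlap c d \<longleftrightarrow> u \<in> img c \<and> chart_inv A c u \<in> cdom d"
  by (auto simp: chart_inv_map)

lemma overlap_subset: "overlap c d \<subseteq> img c"
  by auto

lemma transition_map: "c \<in> charts A \<Longrightarrow> p \<in> cdom c \<Longrightarrow> transition A c d (chart_map A c p) = chart_map A d p"
  by (simp add: transition_def chart_inv_map)

lemma transition_overlap: "c \<in> charts A \<Longrightarrow> transition A c d ` overlap c d \<subseteq> overlap d c"
  by (auto simp: transition_map)

lemma chart_inv_transition:
  "c \<in> charts A \<Longrightarrow> d \<in> charts A \<Longrightarrow> u \<in> overlap c d \<Longrightarrow> chart_inv A d (transition A c d u) = chart_inv A c u"
  by (auto simp: transition_map chart_inv_map)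

lemma transition_has_derivative:
  "c \<in> charts A \<Longrightarrow> d \<in> charts A \<Longrightarrow> p \<in> cdom c \<Longrightarrow> p \<in> cdom d \<Longrightarrow>
    (transition A c d has_derivative D_transition c d p) (at (chart_map A c p))"
  by (rule smooth_on_has_derivative[OF smooth_transition]) auto

lemma D_transition_linear:
  "c \<in> charts A \<Longrightarrow> d \<in> charts A \<Longrightarrow> p \<in> cdom c \<Longrightarrow> p \<in> cdom d \<Longrightarrow> linear (D_transition c d p)"
  using transition_has_derivative has_derivative_linear by blast

lemma D_transition_self:
  assumes "c \<in> charts A" "p \<in> cdom c"
  shows "D_transition c c p w = w"
proof -
  have "((\<lambda>u. u) has_derivative D_transition c c p) (at (chart_map A c p))"
    by (rule has_derivative_transform_within_open[OF transition_has_derivative[OF assms(1,1,2,2)] open_image[OF assms(1)]])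
      (use assms in \<open>auto simp: transition_map\<close>)
  from has_derivative_unique[OF this has_derivative_ident] show ?thesis by simp
qed

text \<open>The chain rule where all three charts are defined. This cocycle identity makes
  \<open>tangent_of\<close> consistent across charts.\<close>

lemma D_transition_compose:
  assumes "c \<in> charts A" "d \<in> charts A" "e \<in> charts A" "p \<in> cdom c" "p \<in> cdom d" "p \<in> cdom e"
  shows "D_transition d e p (D_transition c d p w) = D_transition c e p w"
proof -
  let ?S = "overlap c d \<inter> overlap c e"
  have "((\<lambda>u. transition A d e (transition A c d u)) has_derivative
      (\<lambda>w. D_transition d e p (D_transition c d p w))) (at (chart_map A c p))"
    using has_derivative_compose[OF transition_has_derivative[OF assms(1,2,4,5)], of "transition A d e"]
      transition_has_derivative[OF assms(2,3,5,6)] assms by (simp add: transition_map)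
  then have "(transition A c e has_derivative (\<lambda>w. D_transition d e p (D_transition c d p w))) (at (chart_map A c p))"
  proof (rule has_derivative_transform_within_open)
    show "open ?S" using assms by (auto intro: open_overlap)
    show "chart_map A c p \<in> ?S" using assms by auto
    fix u assume "u \<in> ?S"
    then have "u \<in> overlap c d" "u \<in> overlap c e" by simp_all
    then have "u = chart_map A c (chart_inv A c u)" "chart_inv A c u \<in> cdom c"
      "chart_inv A c u \<in> cdom d" "chart_inv A c u \<in> cdom e"
      using chart_map_inv[of u c] chart_inv_mem[of u c] unfolding overlap_iff[OF assms(1)] by simp_all
    then obtain r where "u = chart_map A c r" "r \<in> cdom c" "r \<in> cdom d" "r \<in> cdom e" by blast
    then show "transition A d e (transition A c d u) = transition A c e u"
      using assms by (simp add: transition_map)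
  qed
  from has_derivative_unique[OF this transition_has_derivative[OF assms(1,3,4,6)]]
  show ?thesis by metis
qed

section \<open>Tangent vectors and the derivative of a function along them\<close>

lemma tangent_of_apply: "d \<in> charts A \<Longrightarrow> p \<in> cdom d \<Longrightarrow> tangent_of A c p w d = D_transition c d p w"
  by (simp add: tangent_of_def charts_at_iff)

lemma tangent_of_self: "c \<in> charts A \<Longrightarrow> p \<in> cdom c \<Longrightarrow> tangent_of A c p w c = w"
  by (simp add: tangent_of_apply D_transition_self)

lemma tangent_of_mem:
  "c \<in> charts A \<Longrightarrow> p \<in> cdom c \<Longrightarrow> tangent_of A c p w \<in> tangent_space A p"
  by (auto simp: tangent_space_def charts_at_iff tangent_of_apply D_transition_compose)
    (simp add: tangent_of_def charts_at_iff)+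

lemma tangent_space_transition:
  "X \<in> tangent_space A p \<Longrightarrow> c \<in> charts A \<Longrightarrow> d \<in> charts A \<Longrightarrow> p \<in> cdom c \<Longrightarrow> p \<in> cdom d \<Longrightarrow>
    X d = D_transition c d p (X c)"
  unfolding tangent_space_def charts_at_def by blast

lemma tangent_spaceI:
  assumes "\<And>c. c \<notin> charts_at A p \<Longrightarrow> X c = 0"
    and "\<And>c d. c \<in> charts A \<Longrightarrow> d \<in> charts A \<Longrightarrow> p \<in> cdom c \<Longrightarrow> p \<in> cdom d \<Longrightarrow> X d = D_transition c d p (X c)"
  shows "X \<in> tangent_space A p"
  unfolding tangent_space_def
proof (intro CollectI conjI allI ballI impI)
  show "X c = 0" if "c \<notin> charts_at A p" for c by (rule assms(1)[OF that])
  show "X d = D_transition c d p (X c)" if "c \<in> charts_at A p" "d \<in> charts_at A p" for c d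
    using that unfolding charts_at_iff by (intro assms(2)) auto
qed

lemma tangent_space_off_chart: "X \<in> tangent_space A p \<Longrightarrow> c \<notin> charts_at A p \<Longrightarrow> X c = 0"
  unfolding tangent_space_def by blast

text \<open>One component determines the others through the transition maps, and off the charts all
  are 0; equality of vectors can thus be checked in a single chart.\<close>

lemma tangent_space_eqI:
  assumes "X \<in> tangent_space A p" "Y \<in> tangent_space A p" "c \<in> charts A" "p \<in> cdom c" "X c = Y c"
  shows "X = Y"
proof
  fix d show "X d = Y d"
  proof (cases "d \<in> charts_at A p")
    case True
    then have "d \<in> charts A" "p \<in> cdom d" by (simp_all add: charts_at_iff)
    from tangent_space_transition[OF assms(1,3) this(1) assms(4) this(2)]
      tangent_space_transition[OF assms(2,3) this(1) assms(4) this(2)] assms(5)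
    show ?thesis by metis
  next
    case False
    then show ?thesis using assms(1,2) by (simp add: tangent_space_off_chart)
  qed
qed

lemma tangent_space_zero: "(\<lambda>_. 0) \<in> tangent_space A p"
  by (rule tangent_spaceI) (simp_all add: linear_0 D_transition_linear)

lemma tangent_space_add:
  assumes "X \<in> tangent_space A p" "Y \<in> tangent_space A p"
  shows "(\<lambda>c. X c + Y c) \<in> tangent_space A p"
proof (rule tangent_spaceI)
  fix c d assume cd: "c \<in> charts A" "d \<in> charts A" "p \<in> cdom c" "p \<in> cdom d"
  show "X d + Y d = D_transition c d p (X c + Y c)"
    unfolding linear_add[OF D_transition_linear[OF cd]]
    using tangent_space_transition[OF assms(1) cd] tangent_space_transition[OF assms(2) cd] by argo
qed (simp add: tangent_space_off_chart[OF assms(1)] tangent_space_off_chart[OF assms(2)])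

lemma tangent_space_scaleR:
  assumes "X \<in> tangent_space A p"
  shows "(\<lambda>c. a *\<^sub>R X c) \<in> tangent_space A p"
proof (rule tangent_spaceI)
  fix c d assume cd: "c \<in> charts A" "d \<in> charts A" "p \<in> cdom c" "p \<in> cdom d"
  show "a *\<^sub>R X d = D_transition c d p (a *\<^sub>R X c)"
    unfolding linear_cmul[OF D_transition_linear[OF cd]]
    using tangent_space_transition[OF assms cd] by argo
qed (simp add: tangent_space_off_chart[OF assms])

lemma has_derivative_chart_change:
  assumes "c \<in> charts A" "d \<in> charts A" "p \<in> cdom c" "p \<in> cdom d"
    and "((f \<circ> chart_inv A d) has_derivative f') (at (chart_map A d p))"
  shows "((f \<circ> chart_inv A c) has_derivative (\<lambda>w. f' (D_transition c d p w))) (at (chart_map A c p))"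
proof -
  have "((\<lambda>u. (f \<circ> chart_inv A d) (transition A c d u)) has_derivative
      (\<lambda>w. f' (D_transition c d p w))) (at (chart_map A c p))"
    using has_derivative_compose[OF transition_has_derivative[OF assms(1-4)], of "f \<circ> chart_inv A d"] assms
    by (simp add: transition_map)
  then show ?thesis
    by (rule has_derivative_transform_within_open[OF _ open_overlap[OF assms(1,2)]])
      (use assms chart_inv_transition[OF assms(1,2)] in auto)
qed

text \<open>\<open>field_apply\<close> evaluates in an arbitrarily chosen chart; the chain rule
  trades it for any given one.\<close>

lemma field_apply_chart:
  assumes "c \<in> charts A" "p \<in> cdom c" "X p \<in> tangent_space A p" "smooth_fun A f"
  shows "field_apply A X f p = frechet_derivative (f \<circ> chart_inv A c) (at (chart_map A c p)) (X p c)"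
proof -
  define d where "d = chart_at A p"
  have d: "d \<in> charts A" "p \<in> cdom d"
    using chart_at_mem[OF mem_points[OF assms(1,2)]] by (auto simp: d_def charts_at_iff)
  have der: "((f \<circ> chart_inv A e) has_derivative frechet_derivative (f \<circ> chart_inv A e) (at (chart_map A e p)))
      (at (chart_map A e p))" if "e \<in> charts A" "p \<in> cdom e" for e
    using assms(4) that by (auto simp: smooth_fun_def intro!: smooth_on_has_derivative)
  from has_derivative_unique[OF der[OF d] has_derivative_chart_change[OF d(1) assms(1) d(2) assms(2) der[OF assms(1,2)]]]
  show ?thesis
    using tangent_space_transition[OF assms(3) d(1) assms(1) d(2) assms(2)]
    unfolding field_apply_def Let_def d_def[symmetric] by metis
qed

section \<open>The topology of an atlas and extension by zero\<close>

lemma open_chart_image: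
  assumes "openin (atlas_topology A) W" "c \<in> charts A"
  shows "open (chart_map A c ` (W \<inter> cdom c))"
proof -
  have "generate_topology_on {cdom c \<inter> chart_map A c -` U |c U. c \<in> charts A \<and> open U} W"
    using assms(1) by (simp add: atlas_topology_def openin_topology_generated_by_iff)
  then show ?thesis
  proof induction
    case Empty
    then show ?case by simp
  next
    case (Int a b)
    \<comment> \<open>Taking images commutes with intersection because the chart is
      injective.\<close>
    have "chart_map A c ` ((a \<inter> b) \<inter> cdom c) = chart_map A c ` (a \<inter> cdom c) \<inter> chart_map A c ` (b \<inter> cdom c)"
      using inj_chart[OF assms(2)] by (auto simp: inj_on_def)
    then show ?case using Int by auto
  next
    case (UN K)
    have "chart_map A c ` (\<Union>K \<inter> cdom c) = (\<Union>k\<in>K. chart_map A c ` (k \<inter> cdom c))" by auto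
    then show ?case using UN by auto
  next
    case (Basis s)
    then obtain d U where d: "d \<in> charts A" "open U" "s = cdom d \<inter> chart_map A d -` U" by blast
    \<comment> \<open>A generating set from another chart d becomes a preimage under the transition
      map, which is continuous on the open overlap.\<close>
    have "chart_map A c ` (s \<inter> cdom c) = overlap c d \<inter> transition A c d -` U"
      using d assms(2) by (auto simp: transition_map)
    then show ?case
      using continuous_open_preimage[OF smooth_on_imp_continuous_on[OF smooth_transition[OF assms(2) d(1)]]
          open_overlap[OF assms(2) d(1)] d(2)] by simp
  qed
qed

lemma continuous_map_chart_inv:
  assumes "c \<in> charts A" "K \<subseteq> img c"
  shows "continuous_map (top_of_set K) (atlas_topology A) (chart_inv A c)"
  unfolding continuous_map_def
proof (intro conjI allI impI)
  show "chart_inv A c \<in> topspace (top_of_set K) \<rightarrow> topspace (atlas_topology A)"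
    using assms chart_inv_mem mem_points by (fastforce simp: topspace_atlas_topology points_eq)
  fix W assume W: "openin (atlas_topology A) W"
  have "{x \<in> topspace (top_of_set K). chart_inv A c x \<in> W} = K \<inter> chart_map A c ` (W \<inter> cdom c)"
    using assms chart_inv_mem chart_map_inv by (auto simp: chart_inv_map)
  then show "openin (top_of_set K) {x \<in> topspace (top_of_set K). chart_inv A c x \<in> W}"
    using open_chart_image[OF W assms(1)] by (auto simp: openin_open)
qed

lemma closedin_chart_inv_compact:
  assumes "c \<in> charts A" "compact K" "K \<subseteq> img c"
  shows "closedin (atlas_topology A) (chart_inv A c ` K)"
  by (rule compactin_imp_closedin[OF Hausdorff
        image_compactin[OF _ continuous_map_chart_inv[OF assms(1,3)]]])
    (simp add: compactin_subtopology assms)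

text \<open>The Hausdorff property makes the image of \<open>K\<close> closed, which is what allows extension by zero.\<close>

lemma smooth_on_extension_by_zero:
  assumes c: "c \<in> charts A" and K: "compact K" "K \<subseteq> img c" and d: "d \<in> charts A"
    and smooth: "smooth_on (overlap d c) f"
    and zero: "\<And>u. u \<in> img d \<Longrightarrow> chart_inv A d u \<notin> chart_inv A c ` K \<Longrightarrow> f u = 0"
  shows "smooth_on (img d) f"
proof (rule smooth_on_local)
  fix u assume u: "u \<in> img d"
  show "\<exists>T. open T \<and> u \<in> T \<and> smooth_on T f"
  proof (cases "chart_inv A d u \<in> cdom c")
    case True
    then show ?thesis using u smooth open_overlap[OF d c] overlap_iff[OF d, of u c] by blast
  next
    case False
    \<comment> \<open>A point outside the domain of c avoids the closed image of K, so W is a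
      neighbourhood of it on which f vanishes identically.\<close>
    define W where "W = points A - chart_inv A c ` K"
    have W: "openin (atlas_topology A) W"
      using closedin_chart_inv_compact[OF c K] unfolding W_def points_eq topspace_atlas_topology[symmetric]
      by (rule openin_diff[OF openin_topspace])
    let ?T = "chart_map A d ` (W \<inter> cdom d)"
    have T: "open ?T" by (rule open_chart_image[OF W d])
    have "chart_inv A d u \<in> W \<inter> cdom d"
      using False K chart_inv_mem u mem_points[OF d] by (fastforce simp: W_def)
    then have "u \<in> ?T" using chart_map_inv[OF u] by (metis image_eqI)
    moreover have "smooth_on ?T f"
      by (rule smooth_on_cong[OF smooth_on_const T])
        (use zero chart_inv_map[OF d] in \<open>auto simp: W_def\<close>)
    ultimately show ?thesis using T by blast
  qed
qed

definition extend_fun :: "'i \<Rightarrow> ('e \<Rightarrow> real) \<Rightarrow> 'm \<Rightarrow> real" where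
  "extend_fun c f p = (if p \<in> cdom c then f (chart_map A c p) else 0)"

definition extend_field :: "'i \<Rightarrow> ('e \<Rightarrow> 'e) \<Rightarrow> 'm \<Rightarrow> 'i \<Rightarrow> 'e" where
  "extend_field c w p = (if p \<in> cdom c then tangent_of A c p (w (chart_map A c p)) else (\<lambda>_. 0))"

lemma smooth_fun_extend_fun:
  assumes "c \<in> charts A" "compact K" "K \<subseteq> img c" "smooth_on (img c) f"
    and "\<And>u. u \<in> img c \<Longrightarrow> u \<notin> K \<Longrightarrow> f u = 0"
  shows "smooth_fun A (extend_fun c f)"
  unfolding smooth_fun_def
proof
  fix d assume d: "d \<in> charts A"
  show "smooth_on (img d) (extend_fun c f \<circ> chart_inv A d)"
  proof (rule smooth_on_extension_by_zero[OF assms(1-3) d])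
    have "smooth_on (overlap d c) (\<lambda>u. f (transition A d c u))"
      using transition_overlap[OF d, of c]
      by (intro smooth_on_compose[OF open_overlap[OF d assms(1)] open_image[OF assms(1)] _ assms(4)]
          smooth_transition d assms(1)) blast
    then show "smooth_on (overlap d c) (extend_fun c f \<circ> chart_inv A d)"
      by (rule smooth_on_cong[OF _ open_overlap[OF d assms(1)]])
        (auto simp: extend_fun_def chart_inv_map d transition_map)
    show "(extend_fun c f \<circ> chart_inv A d) u = 0"
      if "u \<in> img d" "chart_inv A d u \<notin> chart_inv A c ` K" for u
    proof -
      have "chart_map A c (chart_inv A d u) \<notin> K" if "chart_inv A d u \<in> cdom c"
        using that chart_inv_map[OF assms(1) that] \<open>chart_inv A d u \<notin> chart_inv A c ` K\<close>
        by (metis image_eqI)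
      then show ?thesis using assms(5) by (auto simp: extend_fun_def)
    qed
  qed
qed

lemma smooth_on_field_rep_overlap:
  assumes "c \<in> charts A" "d \<in> charts A" "smooth_on (overlap c d) w"
    and "\<And>p. p \<in> cdom c \<Longrightarrow> p \<in> cdom d \<Longrightarrow> X p d = D_transition c d p (w (chart_map A c p))"
  shows "smooth_on (overlap d c) (field_rep A d X)"
proof -
  have "overlap c d = chart_map A c ` (chart_dom A d \<inter> chart_dom A c)" by (simp add: Int_commute)
  then have "smooth_on (overlap d c) (\<lambda>u. frechet_derivative (transition A c d) (at (transition A d c u)) (w (transition A d c u)))"
    using transition_overlap[OF assms(2), of c]
    by (intro smooth_on_frechet_derivative_apply[OF open_overlap[OF assms(2,1)] open_overlap[OF assms(1,2)]]
       smooth_on_compose[OF open_overlap[OF assms(2,1)] open_overlap[OF assms(1,2)] _ assms(3)]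
       smooth_transition assms(1,2))
  then show ?thesis
    by (rule smooth_on_cong[OF _ open_overlap[OF assms(2,1)]])
      (auto simp: field_rep_def chart_inv_map transition_map assms)
qed

lemma vector_fields_extend_field:
  assumes "c \<in> charts A" "compact K" "K \<subseteq> img c" "smooth_on (img c) w"
    and "\<And>u. u \<in> img c \<Longrightarrow> u \<notin> K \<Longrightarrow> w u = 0"
  shows "extend_field c w \<in> vector_fields A"
  unfolding vector_fields_def
proof (intro CollectI conjI allI ballI impI)
  show "extend_field c w p = (\<lambda>_. 0)" if "p \<notin> points A" for p
    using that mem_points[OF assms(1)] by (auto simp: extend_field_def)
  show "extend_field c w p \<in> tangent_space A p" if "p \<in> points A" for p
    using tangent_of_mem[OF assms(1)] tangent_space_zero by (simp add: extend_field_def)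
  fix d assume d: "d \<in> charts A"
  show "smooth_on (img d) (field_rep A d (extend_field c w))"
  proof (rule smooth_on_extension_by_zero[OF assms(1-3) d])
    show "smooth_on (overlap d c) (field_rep A d (extend_field c w))"
      by (rule smooth_on_field_rep_overlap[OF assms(1) d smooth_on_subset[OF assms(4) overlap_subset]])
        (auto simp: extend_field_def tangent_of_apply d)
    show "field_rep A d (extend_field c w) u = 0"
      if u: "u \<in> img d" "chart_inv A d u \<notin> chart_inv A c ` K" for u
    proof (cases "chart_inv A d u \<in> cdom c")
      case True
      then have "chart_map A c (chart_inv A d u) \<notin> K"
        using chart_inv_map[OF assms(1) True] u(2) by (metis image_eqI)
      then have "w (chart_map A c (chart_inv A d u)) = 0" using assms(5) True by auto
      then show ?thesis
        using True linear_0[OF D_transition_linear[OF assms(1) d True chart_inv_mem[OF u(1)]]]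
        by (simp add: field_rep_def extend_field_def tangent_of_apply d chart_inv_mem[OF u(1)])
    qed (simp add: field_rep_def extend_field_def)
  qed
qed

section \<open>Vector fields as a module over smooth functions, and connections on finite
  sums\<close>

lemma smooth_fun_const: "smooth_fun A (\<lambda>_. k)"
  by (simp add: smooth_fun_def comp_def smooth_on_const)

lemma vector_fieldsD:
  assumes "X \<in> vector_fields A"
  shows "p \<notin> points A \<Longrightarrow> X p = (\<lambda>_. 0)"
    and "p \<in> points A \<Longrightarrow> X p \<in> tangent_space A p"
    and "c \<in> charts A \<Longrightarrow> smooth_on (img c) (field_rep A c X)"
  using assms by (auto simp: vector_fields_def)

lemma vector_fields_add:
  assumes "X \<in> vector_fields A" "Y \<in> vector_fields A"
  shows "field_add X Y \<in> vector_fields A"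
  unfolding vector_fields_def
proof (intro CollectI conjI allI ballI impI)
  show "field_add X Y p = (\<lambda>_. 0)" if "p \<notin> points A" for p
    using that assms by (simp add: field_add_def vector_fieldsD)
  show "field_add X Y p \<in> tangent_space A p" if "p \<in> points A" for p
    unfolding field_add_def using that assms by (intro tangent_space_add vector_fieldsD)
  show "smooth_on (img c) (field_rep A c (field_add X Y))" if "c \<in> charts A" for c
    using smooth_on_add[OF open_image[OF that] vector_fieldsD(3)[OF assms(1) that] vector_fieldsD(3)[OF assms(2) that]]
    by (simp add: field_rep_def field_add_def)
qed

lemma vector_fields_scale:
  assumes "smooth_fun A f" "X \<in> vector_fields A"
  shows "field_scale f X \<in> vector_fields A"
  unfolding vector_fields_def
proof (intro CollectI conjI allI ballI impI)
  show "field_scale f X p = (\<lambda>_. 0)" if "p \<notin> points A" for p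
    using that assms by (simp add: field_scale_def vector_fieldsD)
  show "field_scale f X p \<in> tangent_space A p" if "p \<in> points A" for p
    unfolding field_scale_def using that assms by (intro tangent_space_scaleR vector_fieldsD)
  show "smooth_on (img c) (field_rep A c (field_scale f X))" if "c \<in> charts A" for c
    using smooth_on_scaleR[OF open_image[OF that] _ vector_fieldsD(3)[OF assms(2) that], of "f \<circ> chart_inv A c"]
      assms(1) that
    by (simp add: field_rep_def field_scale_def smooth_fun_def comp_def)
qed

lemma tangent_space_sum:
  assumes "\<And>i. i \<in> I \<Longrightarrow> X i \<in> tangent_space A p"
  shows "(\<lambda>c. \<Sum>i\<in>I. a i *\<^sub>R X i c) \<in> tangent_space A p"
  using assms
proof (induction I rule: infinite_finite_induct)
  case (insert i I)
  then show ?case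
    using tangent_space_add[OF tangent_space_scaleR[of "X i" p "a i"]] by simp
qed (simp_all add: tangent_space_zero)

lemma vector_fields_zero: "(\<lambda>_ _. 0) \<in> vector_fields A"
  by (simp add: vector_fields_def tangent_space_zero field_rep_def smooth_on_const)

text \<open>Additivity and the Leibniz rule, iterated. The fibres of \<open>E\<close> have to be
  closed under linear operations because every partial sum must again be a section of
  \<open>E\<close>.\<close>

lemma connection_on_sum:
  assumes conn: "connection_on A E D" and X: "X \<in> vector_fields A" and "finite I"
    and zero: "\<And>p. p \<in> points A \<Longrightarrow> (\<lambda>_. 0) \<in> E p"
    and add: "\<And>p Y Z. p \<in> points A \<Longrightarrow> Y \<in> E p \<Longrightarrow> Z \<in> E p \<Longrightarrow> (\<lambda>c. Y c + Z c) \<in> E p"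
    and scale: "\<And>p Y k. p \<in> points A \<Longrightarrow> Y \<in> E p \<Longrightarrow> (\<lambda>c. k *\<^sub>R Y c) \<in> E p"
    and "\<And>i. i \<in> I \<Longrightarrow> smooth_fun A (a i)" "\<And>i. i \<in> I \<Longrightarrow> Z i \<in> bundle_sections A E"
  shows "(\<lambda>p c. \<Sum>i\<in>I. a i p *\<^sub>R Z i p c) \<in> bundle_sections A E \<and>
    D X (\<lambda>p c. \<Sum>i\<in>I. a i p *\<^sub>R Z i p c) =
      (\<lambda>p c. \<Sum>i\<in>I. field_apply A X (a i) p *\<^sub>R Z i p c + a i p *\<^sub>R D X (Z i) p c)"
  using assms(3,7,8)
proof (induction I rule: finite_induct)
  case empty
  have 0: "(\<lambda>_ _. 0) \<in> bundle_sections A E"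
    using zero vector_fields_zero by (simp add: bundle_sections_def)
  \<comment> \<open>The zero section is the function 0 times itself, so the Leibniz rule yields D X
    0 = 0.\<close>
  have "D X (field_scale (\<lambda>_. 0) (\<lambda>_ _. 0)) =
      field_add (field_scale (field_apply A X (\<lambda>_. 0)) (\<lambda>_ _. 0)) (field_scale (\<lambda>_. 0) (D X (\<lambda>_ _. 0)))"
    using conn 0 X smooth_fun_const unfolding connection_on_def by blast
  then show ?case using 0 by (simp add: field_scale_def field_add_def)
next
  case (insert i I)
  let ?S = "\<lambda>p c. \<Sum>i\<in>I. a i p *\<^sub>R Z i p c"
  have S: "?S \<in> bundle_sections A E" "D X ?S =
      (\<lambda>p c. \<Sum>i\<in>I. field_apply A X (a i) p *\<^sub>R Z i p c + a i p *\<^sub>R D X (Z i) p c)"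
    using insert by auto
  have i: "smooth_fun A (a i)" "Z i \<in> bundle_sections A E" using insert by auto
  have T: "field_scale (a i) (Z i) \<in> bundle_sections A E"
    using i vector_fields_scale scale by (auto simp: bundle_sections_def field_scale_def)
  have sum: "(\<lambda>p c. \<Sum>i\<in>insert i I. a i p *\<^sub>R Z i p c) = field_add (field_scale (a i) (Z i)) ?S"
    using insert.hyps by (simp add: field_add_def field_scale_def)
  have "field_add (field_scale (a i) (Z i)) ?S \<in> bundle_sections A E"
    using T S(1) vector_fields_add add unfolding bundle_sections_def
    by (auto simp: field_add_def)
  moreover have "D X (field_add (field_scale (a i) (Z i)) ?S) = field_add (D X (field_scale (a i) (Z i))) (D X ?S)"
    using conn X T S(1) unfolding connection_on_def by blast
  moreover have "D X (field_scale (a i) (Z i)) =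
      field_add (field_scale (field_apply A X (a i)) (Z i)) (field_scale (a i) (D X (Z i)))"
    using conn X i unfolding connection_on_def by blast
  ultimately show ?case
    unfolding sum S(2) using insert.hyps by (simp add: field_add_def field_scale_def)
qed

end

section \<open>The slit tangent bundle as an atlas\<close>

context smooth_atlas
begin

abbreviation "N \<equiv> slit_tangent_bundle A"
abbreviation "ndom \<equiv> chart_dom N"
abbreviation "nimg c \<equiv> chart_map N c ` ndom c"

lemma slit_charts [simp]: "charts N = charts A"
  by (simp add: slit_tangent_bundle_def)

lemma slit_chart_map [simp]: "chart_map N c q = (chart_map A c (fst q), snd q c)"
  by (simp add: slit_tangent_bundle_def case_prod_beta)

lemma slit_dom_iff:
  "c \<in> charts A \<Longrightarrow> q \<in> ndom c \<longleftrightarrow> fst q \<in> cdom c \<and> snd q \<in> tangent_space A (fst q) \<and> snd q \<noteq> (\<lambda>_. 0)"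
  using mem_points by (cases q) (auto simp: slit_tangent_bundle_def tangent_bundle_def)

lemma slit_points_eq: "points N = (\<Union>c\<in>charts A. ndom c)"
  by (auto simp: slit_tangent_bundle_def tangent_bundle_def points_eq)

lemma slit_points_iff:
  "q \<in> points N \<longleftrightarrow> fst q \<in> points A \<and> snd q \<in> tangent_space A (fst q) \<and> snd q \<noteq> (\<lambda>_. 0)"
  by (cases q) (auto simp: slit_tangent_bundle_def tangent_bundle_def)

lemma tangent_component_nonzero:
  "v \<in> tangent_space A p \<Longrightarrow> v \<noteq> (\<lambda>_. 0) \<Longrightarrow> c \<in> charts A \<Longrightarrow> p \<in> cdom c \<Longrightarrow> v c \<noteq> 0"
  using tangent_space_eqI[OF _ tangent_space_zero, of v p c] by auto

lemma slit_tangent_of_mem: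
  assumes "c \<in> charts A" "p \<in> cdom c" "y \<noteq> 0"
  shows "(p, tangent_of A c p y) \<in> ndom c"
proof -
  have "tangent_of A c p y \<noteq> (\<lambda>_. 0)" using tangent_of_self[OF assms(1,2), of y] assms(3) by metis
  then show ?thesis using assms tangent_of_mem by (simp add: slit_dom_iff)
qed

text \<open>The inclusion from right to left is the substantial one: \<open>tangent_of\<close>
  builds a nonzero tangent vector from any nonzero fibre coordinate.\<close>

lemma slit_image_Int:
  assumes "c \<in> charts A" "d \<in> charts A"
  shows "chart_map N c ` (ndom c \<inter> ndom d) = overlap c d \<times> (- {0::'e})"
proof (intro equalityI subsetI)
  fix u assume "u \<in> chart_map N c ` (ndom c \<inter> ndom d)"
  then show "u \<in> overlap c d \<times> (- {0::'e})"
    using assms tangent_component_nonzero by (fastforce simp: slit_dom_iff)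
next
  fix u assume "u \<in> overlap c d \<times> (- {0::'e})"
  then obtain p y where p: "u = (chart_map A c p, y)" "p \<in> cdom c" "p \<in> cdom d" "y \<noteq> 0" by auto
  let ?q = "(p, tangent_of A c p y)"
  have q: "?q \<in> ndom c" using slit_tangent_of_mem[OF assms(1) p(2,4)] .
  moreover have "?q \<in> ndom d" using q assms p by (simp add: slit_dom_iff)
  moreover have "chart_map N c ?q = u" using assms p by (simp add: tangent_of_self)
  ultimately show "u \<in> chart_map N c ` (ndom c \<inter> ndom d)" by (metis IntI image_eqI)
qed

lemma slit_image: "c \<in> charts A \<Longrightarrow> nimg c = img c \<times> (- {0::'e})"
  using slit_image_Int[of c c] by simp

lemma slit_inj: "c \<in> charts A \<Longrightarrow> inj_on (chart_map N c) (ndom c)"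
proof (rule inj_onI)
  fix q r assume c: "c \<in> charts A" and qr: "q \<in> ndom c" "r \<in> ndom c" "chart_map N c q = chart_map N c r"
  then have "fst q = fst r" using inj_onD[OF inj_chart[OF c]] by (simp add: slit_dom_iff)
  moreover have "snd q = snd r"
    using qr c calculation by (intro tangent_space_eqI[of _ "fst r" _ c]) (auto simp: slit_dom_iff)
  ultimately show "q = r" by (simp add: prod_eq_iff)
qed

text \<open>The fibre coordinate is a component of a tangent vector of the base, so it changes by
  the derivative of the base transition.\<close>

lemma slit_transition:
  assumes "c \<in> charts A" "d \<in> charts A" "u \<in> overlap c d \<times> (- {0::'e})"
  shows "transition N c d u = (transition A c d (fst u), frechet_derivative (transition A c d) (at (fst u)) (snd u))"
proof -
  obtain q where q: "q \<in> ndom c" "q \<in> ndom d" "u = chart_map N c q"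
    using assms(3) unfolding slit_image_Int[OF assms(1,2), symmetric] by blast
  have "transition N c d u = chart_map N d q"
    using q slit_inj[OF assms(1)] by (simp add: transition_def chart_inv_def del: slit_chart_map)
  then show ?thesis
    using q assms tangent_space_transition[of "snd q" "fst q" c d] by (auto simp: slit_dom_iff transition_map)
qed

lemma slit_overlap_open: "c \<in> charts A \<Longrightarrow> d \<in> charts A \<Longrightarrow> open (overlap c d \<times> (- {0::'e}))"
  by (intro open_Times open_overlap open_Compl closed_singleton)

lemma slit_smooth_transition:
  assumes "c \<in> charts A" "d \<in> charts A"
  shows "smooth_on (overlap c d \<times> (- {0::'e})) (transition N c d)"
proof -
  let ?S = "overlap c d \<times> (- {0::'e})"
  note o = slit_overlap_open[OF assms]
  have "smooth_on ?S (\<lambda>u. (transition A c d (fst u), frechet_derivative (transition A c d) (at (fst u)) (snd u)))"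
    by (intro smooth_on_Pair o smooth_on_compose[OF o open_overlap[OF assms] _ smooth_transition[OF assms]]
        smooth_on_frechet_derivative_apply[OF o open_overlap[OF assms] _ smooth_transition[OF assms]]
        smooth_on_fst smooth_on_snd smooth_on_ident) auto
  then show ?thesis by (rule smooth_on_cong[OF _ o]) (simp add: slit_transition[OF assms])
qed

lemma continuous_map_slit_projection: "continuous_map (atlas_topology N) (atlas_topology A) fst"
proof -
  have ts: "topspace (atlas_topology N) = points N"
    by (simp add: topspace_atlas_topology slit_points_eq)
  have "openin (atlas_topology N) (fst -` (cdom c \<inter> chart_map A c -` U) \<inter> points N)"
    if "c \<in> charts A" "open U" for c U
  proof -
    have "fst -` (cdom c \<inter> chart_map A c -` U) \<inter> points N = ndom c \<inter> chart_map N c -` (U \<times> UNIV)"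
      using that mem_points by (auto simp: slit_points_iff slit_dom_iff)
    then show ?thesis using openin_chart_preimage[of c N "U \<times> UNIV"] that by (simp add: open_Times)
  qed
  moreover have "fst q \<in> \<Union>{cdom c \<inter> chart_map A c -` U |c U. c \<in> charts A \<and> open U}" if "q \<in> points N" for q
  proof -
    obtain c where "c \<in> charts A" "fst q \<in> cdom c"
      using \<open>q \<in> points N\<close> by (auto simp: slit_points_iff points_eq)
    then show ?thesis using open_UNIV by blast
  qed
  ultimately show ?thesis
    unfolding atlas_topology_def[of A] continuous_on_generated_topo_iff ts by blast
qed

text \<open>Points over different base points are separated by preimages under the projection,
  points of one fibre by open sets of a common induced chart.\<close>

lemma slit_Hausdorff: "Hausdorff_space (atlas_topology N)"
  unfolding Hausdorff_space_def
proof (intro allI impI)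
  have ts: "topspace (atlas_topology N) = points N"
    by (simp add: topspace_atlas_topology slit_points_eq)
  fix q r assume qr: "q \<in> topspace (atlas_topology N) \<and> r \<in> topspace (atlas_topology N) \<and> q \<noteq> r"
  show "\<exists>U V. openin (atlas_topology N) U \<and> openin (atlas_topology N) V \<and> q \<in> U \<and> r \<in> V \<and> disjnt U V"
  proof (cases "fst q = fst r")
    case False
    have "fst q \<in> topspace (atlas_topology A)" "fst r \<in> topspace (atlas_topology A)"
      using qr continuous_map_slit_projection by (auto simp: continuous_map_def)
    then obtain U V where UV: "openin (atlas_topology A) U" "openin (atlas_topology A) V"
      "fst q \<in> U" "fst r \<in> V" "disjnt U V"
      using Hausdorff False unfolding Hausdorff_space_def by blast
    show ?thesis
      using openin_continuous_map_preimage[OF continuous_map_slit_projection UV(1)]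
        openin_continuous_map_preimage[OF continuous_map_slit_projection UV(2)] UV qr
      by (intro exI[of _ "{x \<in> topspace (atlas_topology N). fst x \<in> U}"]
          exI[of _ "{x \<in> topspace (atlas_topology N). fst x \<in> V}"]) (auto simp: disjnt_def)
  next
    case True
    obtain c where c: "c \<in> charts A" "fst q \<in> cdom c"
      using qr by (auto simp: ts slit_points_iff points_eq)
    have q: "q \<in> ndom c" "r \<in> ndom c"
      using qr True c by (auto simp: ts slit_points_iff slit_dom_iff)
    then have ne: "chart_map N c q \<noteq> chart_map N c r"
      using inj_onD[OF slit_inj[OF c(1)]] qr by blast
    obtain U V where UV: "open U" "open V" "chart_map N c q \<in> U" "chart_map N c r \<in> V" "U \<inter> V = {}"
      using hausdorff[OF ne] by metis
    show ?thesis
    proof (intro exI conjI)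
      show "openin (atlas_topology N) (ndom c \<inter> chart_map N c -` U)"
        "openin (atlas_topology N) (ndom c \<inter> chart_map N c -` V)"
        using openin_chart_preimage[of c N] UV(1,2) c by simp_all
      show "q \<in> ndom c \<inter> chart_map N c -` U" "r \<in> ndom c \<inter> chart_map N c -` V"
        using q UV(3,4) by blast+
      show "disjnt (ndom c \<inter> chart_map N c -` U) (ndom c \<inter> chart_map N c -` V)"
        using UV(5) unfolding disjnt_def by blast
    qed
  qed
qed

lemma slit_smooth_atlas: "smooth_atlas N"
proof
  fix c d assume cd: "c \<in> charts N"
  show "inj_on (chart_map N c) (ndom c)" using slit_inj cd by simp
  show "open (nimg c)" using cd slit_overlap_open[of c c] by (simp only: slit_charts slit_image Int_absorb)
  assume "d \<in> charts N"
  then show "open (chart_map N c ` (ndom c \<inter> ndom d))"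
    "smooth_on (chart_map N c ` (ndom c \<inter> ndom d)) (transition N c d)"
    using cd by (simp_all only: slit_charts slit_image_Int slit_overlap_open slit_smooth_transition)
qed (simp_all only: slit_points_eq slit_charts slit_Hausdorff)

end

section \<open>Finsler metrics and the complement of the Liouville field\<close>

locale finsler = smooth_atlas M for M :: "('i, 'm, real^'n) atlas" +
  fixes F :: "'m \<times> ('i \<Rightarrow> real^'n) \<Rightarrow> real"
  assumes finsler: "finsler_metric M F"

text \<open>From here on each fact about atlases exists twice: unprefixed for the base M, and with
  the prefix \<open>N\<close> for the slit tangent bundle.\<close>

sublocale finsler \<subseteq> N: smooth_atlas "slit_tangent_bundle M"
  by (rule slit_smooth_atlas)

context finsler
begin

abbreviation "nmap \<equiv> chart_map N"
abbreviation "F2 c \<equiv> F_squared M F c"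
abbreviation "dF2 c u \<equiv> frechet_derivative (F_squared M F c) (at u)"

section \<open>Homogeneity of F^2 and Euler's theorem\<close>

lemma F2_nmap: "c \<in> charts M \<Longrightarrow> q \<in> ndom c \<Longrightarrow> F2 c (nmap c q) = (F q)\<^sup>2"
  unfolding F_squared_def using N.chart_inv_map by (simp del: slit_chart_map)

lemma F_positive: "q \<in> points N \<Longrightarrow> F q > 0"
  using finsler unfolding finsler_metric_def slit_tangent_bundle_def
  by (fastforce simp: less_le)

lemma smooth_on_F2:
  assumes "c \<in> charts M"
  shows "smooth_on (nimg c) (F2 c)"
proof -
  have "smooth_on (nimg c) (F \<circ> chart_inv N c)"
    using finsler assms by (simp add: finsler_metric_def smooth_fun_def)
  from smooth_on_mult[OF N.open_image this this] assms
  show ?thesis by (simp add: F_squared_def[abs_def] power2_eq_square comp_def)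
qed

lemma F2_positive:
  assumes "c \<in> charts M" "u \<in> nimg c"
  shows "F2 c u > 0"
  using assms F2_nmap N.mem_points F_positive by (fastforce simp del: slit_chart_map)

lemma dF2_linear: "c \<in> charts M \<Longrightarrow> u \<in> nimg c \<Longrightarrow> linear (dF2 c u)"
  by (rule smooth_on_linear_derivative[OF smooth_on_F2])

text \<open>The flow of Gamma in the multiplicative parameter a = exp t; time 0 corresponds to a =
  1.\<close>

definition ray :: "real \<Rightarrow> 'm \<times> ('i \<Rightarrow> real^'n) \<Rightarrow> 'm \<times> ('i \<Rightarrow> real^'n)" where
  "ray a q = (fst q, \<lambda>c. a *\<^sub>R snd q c)"

lemma ray_mem:
  assumes "c \<in> charts M" "q \<in> ndom c" "a > 0"
  shows "ray a q \<in> ndom c"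
proof -
  have "(\<lambda>c. a *\<^sub>R snd q c) \<noteq> (\<lambda>_. 0)"
    using assms tangent_component_nonzero[of "snd q" "fst q" c] by (auto simp: slit_dom_iff fun_eq_iff)
  then show ?thesis using assms by (auto simp: slit_dom_iff ray_def tangent_space_scaleR)
qed

lemma nmap_ray: "nmap c (ray a q) = (fst (nmap c q), a *\<^sub>R snd (nmap c q))"
  by (simp add: ray_def)

lemma F_ray:
  assumes "q \<in> points N" "a > 0"
  shows "F (ray a q) = a * F q"
proof -
  have "q \<in> tangent_bundle M" using assms(1) by (auto simp: slit_tangent_bundle_def)
  then show ?thesis using finsler assms(2) unfolding finsler_metric_def ray_def by (cases q) fastforce
qed

lemma chart_inv_ray:
  assumes "c \<in> charts M" "q \<in> ndom c" "a > 0"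
  shows "chart_inv N c (fst (nmap c q), a *\<^sub>R snd (nmap c q)) = ray a q"
  using N.chart_inv_map[OF _ ray_mem[OF assms]] assms(1) by (simp add: nmap_ray[symmetric] del: slit_chart_map)

lemma F2_scale:
  assumes "c \<in> charts M" "u \<in> nimg c" "a > 0"
  shows "(fst u, a *\<^sub>R snd u) \<in> nimg c" "F2 c (fst u, a *\<^sub>R snd u) = a\<^sup>2 * F2 c u"
proof -
  obtain q where q: "q \<in> ndom c" "u = nmap c q" using assms(2) by blast
  then have u: "(fst u, a *\<^sub>R snd u) = nmap c (ray a q)" by (simp only: nmap_ray)
  then show "(fst u, a *\<^sub>R snd u) \<in> nimg c" using ray_mem[OF assms(1) q(1) assms(3)] by blast
  show "F2 c (fst u, a *\<^sub>R snd u) = a\<^sup>2 * F2 c u"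
    unfolding u unfolding q
    using F2_nmap[OF assms(1) ray_mem[OF assms(1) q(1) assms(3)]] F2_nmap[OF assms(1) q(1)]
      F_ray[OF _ assms(3), of q] N.mem_points[of c q] q(1) assms(1)
    by (simp add: power_mult_distrib del: slit_chart_map)
qed

end

text \<open>(0, y) are the components of Gamma at (x, y), so the derivative along Gamma becomes a
  derivative in one real variable.\<close>

lemma ray_has_vector_derivative:
  assumes "h differentiable (at u)"
  shows "((\<lambda>a. h (fst u, a *\<^sub>R snd u)) has_vector_derivative frechet_derivative h (at u) (0, snd u)) (at 1)"
proof -
  have 1: "((\<lambda>a. (fst u, a *\<^sub>R snd u)) has_derivative (\<lambda>t. (0, t *\<^sub>R snd u))) (at 1)"
    by (auto intro!: derivative_eq_intros)
  have 2: "(h has_derivative frechet_derivative h (at u)) (at ((\<lambda>a. (fst u, a *\<^sub>R snd u)) 1))"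
    using assms by (simp add: frechet_derivative_works)
  show ?thesis
    using has_derivative_compose[OF 1 2] linear_cmul[OF linear_frechet_derivative[OF assms], of _ "(0, snd u)"]
    by (simp add: has_vector_derivative_def)
qed

context finsler
begin

text \<open>Both sides are the derivative of F^2(x, a y) = a^2 F^2(x, y) in a at a = 1.\<close>

lemma euler_F2:
  assumes "c \<in> charts M" "u \<in> nimg c"
  shows "dF2 c u (0, snd u) = 2 * F2 c u"
proof -
  have "((\<lambda>a. F2 c (fst u, a *\<^sub>R snd u)) has_vector_derivative dF2 c u (0, snd u)) (at 1)"
    by (rule ray_has_vector_derivative[OF smooth_on_differentiable[OF smooth_on_F2[OF assms(1)] assms(2)]])
  moreover have "((\<lambda>a. F2 c (fst u, a *\<^sub>R snd u)) has_vector_derivative 2 * F2 c u) (at 1)"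
  proof (rule has_vector_derivative_transform_within_open[of _ _ _ "{0<..}"])
    show "((\<lambda>a. a\<^sup>2 * F2 c u) has_vector_derivative 2 * F2 c u) (at 1)"
      unfolding has_real_derivative_iff_has_vector_derivative[symmetric]
      by (auto intro!: derivative_eq_intros)
  qed (use F2_scale(2)[OF assms] in auto)
  ultimately show ?thesis by (rule vector_derivative_unique_at)
qed

text \<open>Differentiates the same homogeneity in (x, y) instead of a. As a consequence the kernel
  of dF^2 on vertical vectors does not change along a ray.\<close>

lemma dF2_scale:
  assumes "c \<in> charts M" "u \<in> nimg c" "a > 0"
  shows "dF2 c (fst u, a *\<^sub>R snd u) (0, w) = a * dF2 c u (0, w)"
proof -
  have sc: "((\<lambda>u. (fst u, a *\<^sub>R snd u)) has_derivative (\<lambda>v. (fst v, a *\<^sub>R snd v))) (at u)"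
    by (auto intro!: derivative_eq_intros)
  have "((\<lambda>u. F2 c (fst u, a *\<^sub>R snd u)) has_derivative (\<lambda>v. dF2 c (fst u, a *\<^sub>R snd u) (fst v, a *\<^sub>R snd v))) (at u)"
    using has_derivative_compose[OF sc smooth_on_has_derivative[OF smooth_on_F2[OF assms(1)] F2_scale(1)[OF assms]]] .
  moreover have "((\<lambda>u. F2 c (fst u, a *\<^sub>R snd u)) has_derivative (\<lambda>v. a\<^sup>2 * dF2 c u v)) (at u)"
  proof (rule has_derivative_transform_within_open[OF _ N.open_image assms(2)])
    show "((\<lambda>u. a\<^sup>2 * F2 c u) has_derivative (\<lambda>v. a\<^sup>2 * dF2 c u v)) (at u)"
      by (rule has_derivative_mult_right[OF smooth_on_has_derivative[OF smooth_on_F2[OF assms(1)] assms(2)]])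
  qed (use assms F2_scale(2) in auto)
  ultimately have "dF2 c (fst u, a *\<^sub>R snd u) (fst v, a *\<^sub>R snd v) = a\<^sup>2 * dF2 c u v" for v
    by (rule has_derivative_unique[THEN fun_cong])
  \<comment> \<open>The chain rule multiplies the fibre direction by a; dividing w by a beforehand
    leaves one of the two factors of a^2.\<close>
  from this[of "(0, inverse a *\<^sub>R w)"] show ?thesis
    using linear_cmul[OF dF2_linear[OF assms(1,2)], of "inverse a" "(0, w)"] assms(3)
    by (simp add: power2_eq_square)
qed

lemma dF2_vertical:
  assumes "c \<in> charts M" "u \<in> nimg c"
  shows "dF2 c u (0, w) = (\<Sum>i\<in>UNIV. w $ i * partial_y i (F2 c) u)"
proof -
  have "(0, w) = (\<Sum>i\<in>UNIV. w $ i *\<^sub>R (0 :: real^'n, axis i 1 :: real^'n))"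
    using basis_expansion[of w] by (simp add: prod_eq_iff fst_sum snd_sum scalar_mult_eq_scaleR)
  then have "dF2 c u (0, w) = (\<Sum>i\<in>UNIV. dF2 c u (w $ i *\<^sub>R (0, axis i 1)))"
    using linear_sum[OF dF2_linear[OF assms]] by metis
  then show ?thesis
    by (simp add: linear_cmul[OF dF2_linear[OF assms]] partial_y_def del: scaleR_Pair)
qed

lemma smooth_on_partial_y_F2: "c \<in> charts M \<Longrightarrow> smooth_on (nimg c) (partial_y i (F2 c))"
  unfolding partial_y_def[abs_def] by (rule smooth_on_frechet_derivative[OF smooth_on_F2])

text \<open>Differentiating Euler's identity, that y^i d_i F^2 sums to 2 F^2, along y^k gives d_k
  F^2 + y^i d_k d_i F^2 = 2 d_k F^2. The second derivatives appear in the order in which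
  \<open>fundamental_tensor\<close> takes them.\<close>

lemma fundamental_tensor_euler:
  assumes "c \<in> charts M" "u \<in> nimg c"
  shows "(\<Sum>i\<in>UNIV. snd u $ i * fundamental_tensor M F c u $ k $ i) = 1/2 * partial_y k (F2 c) u"
proof -
  let ?v = "(0 :: real^'n, axis k 1 :: real^'n)"
  let ?p = "\<lambda>i. partial_y i (F2 c)"
  have p: "(?p i has_derivative frechet_derivative (?p i) (at u)) (at u)" for i
    by (rule smooth_on_has_derivative[OF smooth_on_partial_y_F2[OF assms(1)] assms(2)])
  have "((\<lambda>u. \<Sum>i\<in>UNIV. snd u $ i * ?p i u) has_derivative
      (\<lambda>v. \<Sum>i\<in>UNIV. snd u $ i * frechet_derivative (?p i) (at u) v + snd v $ i * ?p i u)) (at u)"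
    by (intro has_derivative_sum has_derivative_mult p bounded_linear.has_derivative[OF bounded_linear_vec_nth]
        has_derivative_snd has_derivative_ident)
  moreover have "((\<lambda>u. \<Sum>i\<in>UNIV. snd u $ i * ?p i u) has_derivative (\<lambda>v. 2 * dF2 c u v)) (at u)"
  proof (rule has_derivative_transform_within_open[OF _ N.open_image assms(2)])
    show "((\<lambda>u. 2 * F2 c u) has_derivative (\<lambda>v. 2 * dF2 c u v)) (at u)"
      by (rule has_derivative_mult_right[OF smooth_on_has_derivative[OF smooth_on_F2[OF assms(1)] assms(2)]])
  qed (use assms euler_F2 dF2_vertical in auto)
  ultimately have "(\<Sum>i\<in>UNIV. snd u $ i * frechet_derivative (?p i) (at u) ?v + snd ?v $ i * ?p i u) = 2 * dF2 c u ?v"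
    by (rule has_derivative_unique[THEN fun_cong])
  then have "(\<Sum>i\<in>UNIV. snd u $ i * partial_y k (?p i) u) = partial_y k (F2 c) u"
    by (simp add: sum.distrib axis_def if_distrib[of "\<lambda>x. x * _"] cong: if_cong) (simp add: partial_y_def axis_def)
  then show ?thesis
    by (simp add: fundamental_tensor_def sum_distrib_left[symmetric] sum_divide_distrib[symmetric])
qed

lemma fundamental_tensor_inner:
  assumes "c \<in> charts M" "u \<in> nimg c"
  shows "w \<bullet> (fundamental_tensor M F c u *v snd u) = 1/2 * dF2 c u (0, w)"
proof -
  have "w \<bullet> (fundamental_tensor M F c u *v snd u)
      = (\<Sum>k\<in>UNIV. w $ k * (\<Sum>i\<in>UNIV. snd u $ i * fundamental_tensor M F c u $ k $ i))"
    by (simp add: inner_vec_def matrix_vector_mult_def mult.commute)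
  also have "\<dots> = 1/2 * dF2 c u (0, w)"
    unfolding fundamental_tensor_euler[OF assms] dF2_vertical[OF assms]
    by (simp add: sum_distrib_left)
  finally show ?thesis .
qed

text \<open>With x fixed the change of induced charts is linear in y, hence its own derivative. The
  result depends on q only through its base point, which is what permits comparing vertical vectors
  along a ray.\<close>

lemma slit_D_transition_vertical:
  assumes "c \<in> charts M" "d \<in> charts M" "q \<in> ndom c" "q \<in> ndom d"
  shows "N.D_transition c d q (0, w) = (0, D_transition c d (fst q) w)"
proof -
  let ?x = "chart_map M c (fst q)" and ?y = "snd q c"
  have p: "fst q \<in> cdom c" "fst q \<in> cdom d" "?y \<noteq> 0"
    using assms tangent_component_nonzero by (auto simp: slit_dom_iff)
  have 1: "(Pair ?x has_derivative (\<lambda>w. (0, w))) (at ?y)"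
    by (auto intro!: derivative_eq_intros)
  have "(transition N c d has_derivative N.D_transition c d q) (at (?x, ?y))"
    using N.transition_has_derivative[of c d q] assms by simp
  from has_derivative_compose[OF 1 this]
  have "((\<lambda>y. transition N c d (?x, y)) has_derivative (\<lambda>w. N.D_transition c d q (0, w))) (at ?y)" .
  moreover have "((\<lambda>y. transition N c d (?x, y)) has_derivative (\<lambda>w. (0, D_transition c d (fst q) w))) (at ?y)"
  proof (rule has_derivative_transform_within_open[of _ _ _ _ "- {0}"])
    have "bounded_linear (D_transition c d (fst q))"
      using has_derivative_bounded_linear[OF transition_has_derivative] assms(1,2) p by blast
    then show "((\<lambda>y. (chart_map M d (fst q), D_transition c d (fst q) y)) has_derivative
        (\<lambda>w. (0, D_transition c d (fst q) w))) (at ?y)"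
      by (intro has_derivative_Pair has_derivative_const bounded_linear_imp_has_derivative)
    show "(chart_map M d (fst q), D_transition c d (fst q) y) = transition N c d (?x, y)" if "y \<in> - {0}" for y
      using that p assms(1,2) by (subst slit_transition) (auto simp: transition_map)
  qed (use p in auto)
  ultimately show ?thesis by (rule has_derivative_unique[THEN fun_cong])
qed

text \<open>A change of charts maps vertical vectors to vertical vectors, so one chart
  decides.\<close>

lemma vertical_iff:
  assumes "c \<in> charts M" "q \<in> ndom c"
  shows "X \<in> vertical_space M q \<longleftrightarrow> X \<in> tangent_space N q \<and> fst (X c) = 0"
proof
  assume X: "X \<in> tangent_space N q \<and> fst (X c) = 0"
  have "fst (X d) = 0" if "d \<in> charts_at N q" for d
  proof -
    have d: "d \<in> charts M" "q \<in> ndom d" using that by (auto simp: N.charts_at_iff)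
    have "X c = (0, snd (X c))" using X by (simp add: prod_eq_iff)
    then have "X d = N.D_transition c d q (0, snd (X c))"
      using N.tangent_space_transition[of X q c d] X assms d by simp
    then show ?thesis using slit_D_transition_vertical[OF assms(1) d(1) assms(2) d(2)] by simp
  qed
  then show "X \<in> vertical_space M q" using X by (simp add: vertical_space_def)
qed (use assms in \<open>auto simp: vertical_space_def N.charts_at_iff\<close>)

lemma dF2_chart_independent:
  assumes "c \<in> charts M" "d \<in> charts M" "q \<in> ndom c" "q \<in> ndom d" "X \<in> tangent_space N q"
  shows "dF2 c (nmap c q) (X c) = dF2 d (nmap d q) (X d)"
proof -
  have eq: "F2 e = (\<lambda>r. (F r)\<^sup>2) \<circ> chart_inv N e" for e by (simp add: fun_eq_iff F_squared_def)
  have der: "(F2 e has_derivative dF2 e (nmap e q)) (at (nmap e q))" if "e \<in> charts M" "q \<in> ndom e" for e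
    using smooth_on_has_derivative[OF smooth_on_F2[OF that(1)]] that(2) by blast
  have "(F2 c has_derivative (\<lambda>w. dF2 d (nmap d q) (N.D_transition c d q w))) (at (nmap c q))"
    unfolding eq
    by (rule N.has_derivative_chart_change[OF _ _ _ _ der[of d, unfolded eq]]) (use assms in simp_all)
  from has_derivative_unique[OF der[OF assms(1,3)] this]
  show ?thesis using N.tangent_space_transition[of X q c d] assms by (metis slit_charts)
qed

text \<open>By Euler's theorem the Sasaki product with \<open>\<Gamma>\<close> is half the differential of \<open>F\<^sup>2\<close>, which makes its
  independence of the chart evident.\<close>

lemma sasaki_liouville:
  assumes "c \<in> charts M" "q \<in> ndom c" "X \<in> vertical_space M q"
  shows "sasaki_metric M F q X (liouville M q) = 1/2 * dF2 c (nmap c q) (X c)"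
proof -
  define d where "d = chart_at N q"
  have q: "q \<in> points N" using N.mem_points assms by simp
  have d: "d \<in> charts M" "q \<in> ndom d"
    using N.chart_at_mem[OF q] by (auto simp: d_def N.charts_at_iff)
  have X: "fst (X d) = 0" "X \<in> tangent_space N q" using vertical_iff[OF d] assms(3) by auto
  have L: "liouville M q d = (0, snd (nmap d q))" using q by (simp add: liouville_def)
  have v: "vertical_component M F d (nmap d q) w = snd w" if "fst w = 0" for w
    using that by (simp add: vertical_component_def vec_eq_iff)
  have "sasaki_metric M F q X (liouville M q) = 1/2 * dF2 d (nmap d q) (0, snd (X d))"
    unfolding sasaki_metric_def Let_def d_def[symmetric]
    using fundamental_tensor_inner[OF d(1), of "nmap d q" "snd (X d)"] d(2) X
    by (simp add: v L del: slit_chart_map)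
  also have "(0, snd (X d)) = X d" using X by (simp add: prod_eq_iff)
  finally show ?thesis using dF2_chart_independent[OF assms(1) d(1) assms(2) d(2) X(2)] by simp
qed

text \<open>Frees L' from the chart chosen inside \<open>sasaki_metric\<close>: in any chart it is
  cut out by two linear conditions on the components.\<close>

lemma complement_iff:
  assumes "c \<in> charts M" "q \<in> ndom c"
  shows "X \<in> liouville_complement M F q \<longleftrightarrow>
    X \<in> tangent_space N q \<and> fst (X c) = 0 \<and> dF2 c (nmap c q) (X c) = 0"
proof -
  have "sasaki_metric M F q X (liouville M q) = 0 \<longleftrightarrow> dF2 c (nmap c q) (X c) = 0" if "X \<in> vertical_space M q"
    unfolding sasaki_liouville[OF assms that] by simp
  then show ?thesis using vertical_iff[OF assms] unfolding liouville_complement_def by blast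
qed

end

section \<open>Brackets with the Liouville field\<close>

context finsler
begin

abbreviation "\<Gamma> \<equiv> liouville M"
abbreviation "comp_at \<equiv> liouville_complement M F"
abbreviation "comp_sections \<equiv> bundle_sections N (liouville_complement M F)"

section \<open>Gamma as a smooth vector field\<close>

lemma liouville_apply: "q \<in> points N \<Longrightarrow> \<Gamma> q c = (0, snd q c)"
  by (simp add: liouville_def)

lemma slit_points_chart:
  assumes "q \<in> points N"
  obtains c where "c \<in> charts M" "q \<in> ndom c"
  using assms unfolding slit_points_eq by blast

lemma slit_mem_points: "c \<in> charts M \<Longrightarrow> q \<in> ndom c \<Longrightarrow> q \<in> points N"
  using N.mem_points by simp

text \<open>Vertical components and the fibre coordinate obey the same law under a change of charts,
  and the vertical component of Gamma is the fibre coordinate.\<close>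

lemma liouville_tangent:
  assumes "q \<in> points N"
  shows "\<Gamma> q \<in> tangent_space N q"
proof (rule N.tangent_spaceI)
  have v: "fst q \<in> points M" "snd q \<in> tangent_space M (fst q)" "snd q \<noteq> (\<lambda>_. 0)"
    using assms by (auto simp: slit_points_iff)
  show "\<Gamma> q c = 0" if "c \<notin> charts_at N q" for c
  proof -
    have "c \<notin> charts_at M (fst q)" using that v by (auto simp: charts_at_iff N.charts_at_iff slit_dom_iff)
    then show ?thesis
      using tangent_space_off_chart[OF v(2)] liouville_apply[OF assms] by (simp add: zero_prod_def)
  qed
  fix c d assume cd: "c \<in> charts N" "d \<in> charts N" "q \<in> ndom c" "q \<in> ndom d"
  then show "\<Gamma> q d = N.D_transition c d q (\<Gamma> q c)"
    using slit_D_transition_vertical[of c d q "snd q c"] tangent_space_transition[OF v(2), of c d]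
    by (simp add: liouville_apply[OF assms] slit_dom_iff del: slit_chart_map)
qed

lemma liouville_rep: "c \<in> charts M \<Longrightarrow> u \<in> nimg c \<Longrightarrow> field_rep N c \<Gamma> u = (0, snd u)"
  using N.chart_inv_map[of c] slit_mem_points[of c]
  by (auto simp: field_rep_def liouville_apply simp del: slit_chart_map) (simp add: liouville_apply)

lemma liouville_field: "\<Gamma> \<in> vector_fields N"
  unfolding vector_fields_def
proof (intro CollectI conjI allI ballI impI)
  fix c assume c: "c \<in> charts N"
  have "smooth_on (nimg c) (\<lambda>u. (0 :: real^'n, snd u :: real^'n))"
    using N.open_image[OF c] by (intro smooth_on_Pair smooth_on_const smooth_on_snd smooth_on_ident)
  then show "smooth_on (nimg c) (field_rep N c \<Gamma>)"
    by (rule smooth_on_cong[OF _ N.open_image[OF c]]) (use liouville_rep c in simp)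
next
  show "\<Gamma> q = (\<lambda>_. 0)" if "q \<notin> points N" for q using that by (simp add: liouville_def)
qed (rule liouville_tangent)

section \<open>Linear structure of L' and the projection onto it\<close>

lemma complementD:
  assumes "c \<in> charts M" "q \<in> ndom c" "X \<in> comp_at q"
  shows "X \<in> tangent_space N q" "fst (X c) = 0" "dF2 c (nmap c q) (X c) = 0"
  using assms complement_iff by blast+

lemma complement_vertical: "X \<in> comp_at q \<Longrightarrow> X \<in> vertical_space M q"
  by (simp add: liouville_complement_def)

lemma complement_add:
  assumes "q \<in> points N" "X \<in> comp_at q" "Y \<in> comp_at q"
  shows "(\<lambda>d. X d + Y d) \<in> comp_at q"
proof -
  obtain c where c: "c \<in> charts M" "q \<in> ndom c" using slit_points_chart assms(1) by blast
  then have "linear (dF2 c (nmap c q))" by (intro dF2_linear) auto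
  then show ?thesis
    using complementD[OF c assms(2)] complementD[OF c assms(3)]
    by (simp add: complement_iff[OF c] N.tangent_space_add linear_add del: slit_chart_map)
qed

lemma complement_scaleR:
  assumes "q \<in> points N" "X \<in> comp_at q"
  shows "(\<lambda>d. a *\<^sub>R X d) \<in> comp_at q"
proof -
  obtain c where c: "c \<in> charts M" "q \<in> ndom c" using slit_points_chart assms(1) by blast
  then have "linear (dF2 c (nmap c q))" by (intro dF2_linear) auto
  then show ?thesis
    using complementD[OF c assms(2)]
    by (simp add: complement_iff[OF c] N.tangent_space_scaleR linear_cmul del: slit_chart_map)
qed

text \<open>Since dF^2(a Gamma) = 2 a F^2 with F^2 > 0, the space L' meets the Liouville line only
  in 0. This turns identities modulo Gamma between elements of L' into exact ones.\<close>

lemma complement_liouville_multiple: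
  assumes "c \<in> charts M" "q \<in> ndom c" "X \<in> comp_at q" "X c = a *\<^sub>R \<Gamma> q c"
  shows "X = (\<lambda>_. 0)"
proof -
  have q: "q \<in> points N" using slit_mem_points assms by blast
  have u: "nmap c q \<in> nimg c" using assms(2) by blast
  have "dF2 c (nmap c q) (a *\<^sub>R (0, snd (nmap c q))) = 0"
    using complementD(3)[OF assms(1-3)] assms(4) liouville_apply[OF q] by simp
  then have "a = 0"
    using linear_cmul[OF dF2_linear[OF assms(1) u]] euler_F2[OF assms(1) u] F2_positive[OF assms(1) u]
    by (simp del: slit_chart_map scaleR_Pair)
  then show ?thesis
    using N.tangent_space_eqI[OF complementD(1)[OF assms(1-3)] N.tangent_space_zero, of c] assms by simp
qed

lemma proj_complement_eq:
  assumes "q \<in> points N" "W \<in> comp_at q"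
  shows "proj_complement M F q (\<lambda>d. W d + a *\<^sub>R \<Gamma> q d) = W"
  unfolding proj_complement_def
proof (rule the_equality)
  show "W \<in> comp_at q \<and> (\<exists>U\<in>liouville_line M q. (\<lambda>d. W d + a *\<^sub>R \<Gamma> q d) = (\<lambda>d. W d + U d))"
    using assms by (auto simp: liouville_line_def)
  fix V assume V: "V \<in> comp_at q \<and> (\<exists>U\<in>liouville_line M q. (\<lambda>d. W d + a *\<^sub>R \<Gamma> q d) = (\<lambda>d. V d + U d))"
  then obtain b where "(\<lambda>d. W d + a *\<^sub>R \<Gamma> q d) = (\<lambda>d. V d + b *\<^sub>R \<Gamma> q d)"
    unfolding liouville_line_def by blast
  from fun_cong[OF this] have b: "W d + a *\<^sub>R \<Gamma> q d = V d + b *\<^sub>R \<Gamma> q d" for d .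
  \<comment> \<open>V - W, in a form to which the closure lemmas apply: it is a multiple of Gamma
    and lies in L', hence vanishes.\<close>
  have eq: "V d + (-1) *\<^sub>R W d = (a - b) *\<^sub>R \<Gamma> q d" for d
    using b[of d] by (simp add: algebra_simps)
  obtain c where c: "c \<in> charts M" "q \<in> ndom c" using slit_points_chart assms(1) by blast
  have "(\<lambda>d. V d + (-1) *\<^sub>R W d) \<in> comp_at q"
    using V assms by (intro complement_add complement_scaleR) blast+
  then have "(\<lambda>d. V d + (-1) *\<^sub>R W d) = (\<lambda>_. 0)"
    using complement_liouville_multiple[OF c] eq by blast
  then have "V d + (-1) *\<^sub>R W d = 0" for d by (rule fun_cong)
  then show "V = W" by (simp add: fun_eq_iff)
qed

lemma proj_complement_self: "q \<in> points N \<Longrightarrow> W \<in> comp_at q \<Longrightarrow> proj_complement M F q W = W"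
  using proj_complement_eq[of q W 0] by simp

lemma vertical_decomposition:
  assumes "q \<in> points N" "X \<in> vertical_space M q"
  shows "\<exists>a. X = (\<lambda>d. proj_complement M F q X d + a *\<^sub>R \<Gamma> q d)"
proof -
  obtain c where c: "c \<in> charts M" "q \<in> ndom c" using slit_points_chart assms(1) by blast
  then have u: "nmap c q \<in> nimg c" by blast
  \<comment> \<open>This is G(X, Gamma) / G(Gamma, Gamma), because G(X, Gamma) = dF^2(X) / 2 and
    G(Gamma, Gamma) = F^2.\<close>
  define a where "a = dF2 c (nmap c q) (X c) / (2 * F2 c (nmap c q))"
  define W where "W = (\<lambda>d. X d + (- a) *\<^sub>R \<Gamma> q d)"
  have X: "X \<in> tangent_space N q" "fst (X c) = 0" using vertical_iff[OF c] assms(2) by auto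
  have "dF2 c (nmap c q) (\<Gamma> q c) = 2 * F2 c (nmap c q)"
    using euler_F2[OF c(1) u] liouville_apply[OF assms(1)] by simp
  then have "dF2 c (nmap c q) (W c) = 0"
    using F2_positive[OF c(1) u] unfolding W_def linear_add[OF dF2_linear[OF c(1) u]] linear_cmul[OF dF2_linear[OF c(1) u]]
    by (simp add: a_def del: slit_chart_map)
  moreover have "W \<in> tangent_space N q"
    unfolding W_def using X liouville_tangent[OF assms(1)] by (intro N.tangent_space_add N.tangent_space_scaleR)
  moreover have "fst (W c) = 0" using X by (simp add: W_def liouville_apply[OF assms(1)])
  ultimately have "W \<in> comp_at q" using complement_iff[OF c] by blast
  from proj_complement_eq[OF assms(1) this, of a] have "proj_complement M F q X = W"
    by (simp add: W_def)
  then show ?thesis by (intro exI[of _ a]) (simp add: W_def)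
qed

text \<open>In a chart the coefficient is the quotient of the Euclidean products of Y with y and of
  y with y. The denominator is nonzero off the zero section, which gives smoothness.\<close>

lemma liouville_multiple_field:
  assumes "Y \<in> vector_fields N" "\<And>q. q \<in> points N \<Longrightarrow> \<exists>a. Y q = (\<lambda>d. a *\<^sub>R \<Gamma> q d)"
  obtains a where "smooth_fun N a" "Y = field_scale a \<Gamma>"
proof -
  obtain a where a: "\<And>q. q \<in> points N \<Longrightarrow> Y q = (\<lambda>d. a q *\<^sub>R \<Gamma> q d)"
    using assms(2) by metis
  have "Y q = field_scale a \<Gamma> q" for q
    using a N.vector_fieldsD(1)[OF assms(1)] N.vector_fieldsD(1)[OF liouville_field]
    by (cases "q \<in> points N") (simp_all add: field_scale_def)
  then have "Y = field_scale a \<Gamma>" by blast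
  moreover have "smooth_fun N a"
    unfolding smooth_fun_def
  proof
    fix c assume c: "c \<in> charts N"
    have "smooth_on (nimg c) (\<lambda>u. (snd (field_rep N c Y u) \<bullet> snd u) / (snd u \<bullet> snd u))"
      using N.open_image[OF c] N.vector_fieldsD(3)[OF assms(1) c] slit_image[of c] c
      by (intro smooth_on_divide smooth_on_inner smooth_on_snd smooth_on_ident) (auto simp del: slit_chart_map)
    then show "smooth_on (nimg c) (a \<circ> chart_inv N c)"
    proof (rule smooth_on_cong[OF _ N.open_image[OF c]])
      fix u assume u: "u \<in> nimg c"
      then have "snd u \<noteq> 0" using slit_image[of c] c by auto
      moreover have "field_rep N c Y u = a (chart_inv N c u) *\<^sub>R field_rep N c \<Gamma> u"
        using a[OF N.mem_points[OF c N.chart_inv_mem[OF u]]] by (simp add: field_rep_def)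
      ultimately show "(snd (field_rep N c Y u) \<bullet> snd u) / (snd u \<bullet> snd u) = (a \<circ> chart_inv N c) u"
        using liouville_rep[of c u] u c by simp
    qed
  qed
  ultimately show thesis using that by blast
qed

section \<open>Differentiation of sections along the rays\<close>

abbreviation "d_rep c Z q \<equiv> frechet_derivative (field_rep N c Z) (at (nmap c q)) (0, snd q c)"

text \<open>Any fixed linear map L commutes with the derivative along the ray, so a linear relation
  that Z satisfies at all points of the ray is inherited by \<open>d_rep\<close>.\<close>

lemma field_along_ray:
  assumes "c \<in> charts M" "q \<in> ndom c" "Z \<in> vector_fields N" "bounded_linear L"
    and "\<And>a. a > 0 \<Longrightarrow> L (Z (ray a q) c) = h a" "(h has_vector_derivative h') (at 1)"
  shows "L (d_rep c Z q) = h'"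
proof -
  have "((\<lambda>a. field_rep N c Z (fst (nmap c q), a *\<^sub>R snd (nmap c q))) has_vector_derivative
      frechet_derivative (field_rep N c Z) (at (nmap c q)) (0, snd (nmap c q))) (at 1)"
    using assms N.vector_fieldsD(3)[OF assms(3), of c]
    by (intro ray_has_vector_derivative smooth_on_differentiable[of "nimg c"]) auto
  then have "((\<lambda>a. L (field_rep N c Z (fst (nmap c q), a *\<^sub>R snd (nmap c q)))) has_vector_derivative
      L (d_rep c Z q)) (at 1)"
    by (intro bounded_linear.has_vector_derivative[OF assms(4)]) simp
  then have "(h has_vector_derivative L (d_rep c Z q)) (at 1)"
  proof (rule has_vector_derivative_transform_within_open[of _ _ _ "{0<..}"])
    show "L (field_rep N c Z (fst (nmap c q), a *\<^sub>R snd (nmap c q))) = h a" if "a \<in> {0<..}" for a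
      using assms(5)[of a] chart_inv_ray[OF assms(1,2), of a] that by (simp add: field_rep_def del: slit_chart_map)
  qed auto
  then show ?thesis using assms(6) by (rule vector_derivative_unique_at)
qed

lemma comp_sectionsD:
  assumes "Z \<in> comp_sections"
  shows "Z \<in> vector_fields N" "q \<in> points N \<Longrightarrow> Z q \<in> comp_at q"
  using assms by (auto simp: bundle_sections_def)

text \<open>Three uses of \<open>field_along_ray\<close>: L is the x-part, dF^2 at q, or the
  derivative at q of the change of charts. Each L is frozen at q and still fits Z along the whole
  ray, by \<open>dF2_scale\<close> and \<open>slit_D_transition_vertical\<close>.\<close>

lemma d_rep_complement:
  assumes "c \<in> charts M" "q \<in> ndom c" "Z \<in> comp_sections"
  shows "fst (d_rep c Z q) = 0" "dF2 c (nmap c q) (d_rep c Z q) = 0"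
    and "d \<in> charts M \<Longrightarrow> q \<in> ndom d \<Longrightarrow> d_rep d Z q = N.D_transition c d q (d_rep c Z q)"
proof -
  note Z = comp_sectionsD[OF assms(3)]
  have r: "ray a q \<in> ndom c" if "a > 0" for a using ray_mem assms that by blast
  have Zr: "Z (ray a q) \<in> comp_at (ray a q)" if "a > 0" for a
    using Z(2) slit_mem_points[OF assms(1) r[OF that]] by blast
  have u: "nmap c q \<in> nimg c" using assms(2) by blast
  note fst0 = complementD(2)[OF assms(1) r Zr]
  show "fst (d_rep c Z q) = 0"
    by (rule field_along_ray[OF assms(1,2) Z(1) bounded_linear_fst fst0]) auto
  show "dF2 c (nmap c q) (d_rep c Z q) = 0"
  proof (rule field_along_ray[OF assms(1,2) Z(1)])
    show "bounded_linear (dF2 c (nmap c q))"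
      using smooth_on_has_derivative[OF smooth_on_F2[OF assms(1)] u] has_derivative_bounded_linear by blast
    fix a :: real assume a: "a > 0"
    have "Z (ray a q) c = (0, snd (Z (ray a q) c))" using fst0[OF a a] by (simp add: prod_eq_iff)
    then show "dF2 c (nmap c q) (Z (ray a q) c) = 0"
      using complementD(3)[OF assms(1) r[OF a] Zr[OF a]] dF2_scale[OF assms(1) u a, of "snd (Z (ray a q) c)"] a
      unfolding nmap_ray by (metis mult_eq_0_iff less_irrefl)
  qed auto
  assume d: "d \<in> charts M" "q \<in> ndom d"
  have "N.D_transition c d q (d_rep c Z q) = d_rep d Z q"
  proof (rule field_along_ray[OF assms(1,2) Z(1)])
    show "bounded_linear (N.D_transition c d q)"
      using N.transition_has_derivative[of c d q] assms(1,2) d has_derivative_bounded_linear by simp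
    show "N.D_transition c d q (Z (ray a q) c) = Z (ray a q) d" if a: "a > 0" for a
    proof -
      have rd: "ray a q \<in> ndom d" using ray_mem d a by blast
      have "Z (ray a q) c = (0, snd (Z (ray a q) c))" using fst0[OF a a] by (simp add: prod_eq_iff)
      then have "N.D_transition c d q (Z (ray a q) c) = N.D_transition c d (ray a q) (Z (ray a q) c)"
        using slit_D_transition_vertical[OF assms(1) d(1) assms(2) d(2)]
          slit_D_transition_vertical[OF assms(1) d(1) r[OF a] rd]
        by (metis ray_def fst_conv)
      then show ?thesis
        using N.tangent_space_transition[OF complementD(1)[OF assms(1) r[OF a] Zr[OF a]], of c d] assms(1) d rd r[OF a]
        by simp
    qed
    show "((\<lambda>a. Z (ray a q) d) has_vector_derivative d_rep d Z q) (at 1)"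
    proof (rule has_vector_derivative_transform_within_open[of _ _ _ "{0<..}"])
      show "((\<lambda>a. field_rep N d Z (fst (nmap d q), a *\<^sub>R snd (nmap d q))) has_vector_derivative d_rep d Z q) (at 1)"
        using ray_has_vector_derivative[OF smooth_on_differentiable[OF N.vector_fieldsD(3)[OF Z(1), of d]], of "nmap d q"] d
        by auto
    qed (use chart_inv_ray[OF d] in \<open>auto simp: field_rep_def\<close>)
  qed
  then show "d_rep d Z q = N.D_transition c d q (d_rep c Z q)" by simp
qed

text \<open>Gamma is linear in the fibre coordinate: its derivative keeps the y-part and kills the
  x-part of a vector, so it fixes the vertical vector Z.\<close>

lemma lie_bracket_liouville:
  assumes "c \<in> charts M" "q \<in> ndom c" "Z \<in> comp_sections"
  shows "lie_bracket N \<Gamma> Z q c = d_rep c Z q - Z q c"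
proof -
  have q: "q \<in> points N" using slit_mem_points assms by blast
  have "((\<lambda>u. (0, snd u)) has_derivative (\<lambda>v. (0, snd v))) (at (nmap c q))"
    by (auto intro!: derivative_eq_intros)
  then have "(field_rep N c \<Gamma> has_derivative (\<lambda>v. (0, snd v))) (at (nmap c q))"
    by (rule has_derivative_transform_within_open[OF _ N.open_image[of c]])
      (use assms liouville_rep in auto)
  then have "frechet_derivative (field_rep N c \<Gamma>) (at (nmap c q)) = (\<lambda>v. (0, snd v))"
    by (rule frechet_derivative_at[symmetric])
  moreover have "(0, snd (Z q c)) = Z q c"
    using complementD(2)[OF assms(1,2) comp_sectionsD(2)[OF assms(3) q]] by (simp add: prod_eq_iff)
  ultimately show ?thesis
    using assms by (simp add: lie_bracket_def N.charts_at_iff liouville_apply[OF q] del: slit_chart_map)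
qed

lemma lie_bracket_liouville_complement:
  assumes "q \<in> points N" "Z \<in> comp_sections"
  shows "lie_bracket N \<Gamma> Z q \<in> comp_at q"
proof -
  obtain c where c: "c \<in> charts M" "q \<in> ndom c" using slit_points_chart assms(1) by blast
  \<comment> \<open>The derivative of Z along Gamma as a family of components. For arbitrary fields
    this is not a tangent vector; for sections of L' it is, by the third part of
    \<open>d_rep_complement\<close>.\<close>
  define T where "T = (\<lambda>d. if d \<in> charts_at N q then d_rep d Z q else 0)"
  have "T \<in> tangent_space N q"
  proof (rule N.tangent_spaceI)
    show "T d = 0" if "d \<notin> charts_at N q" for d using that by (simp add: T_def)
    fix d e assume de: "d \<in> charts N" "e \<in> charts N" "q \<in> ndom d" "q \<in> ndom e"
    then have Td: "T d = d_rep d Z q" and Te: "T e = d_rep e Z q" by (simp_all add: T_def N.charts_at_iff)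
    show "T e = N.D_transition d e q (T d)"
      unfolding Td Te by (rule d_rep_complement(3)[OF _ _ assms(2)]) (use de in simp_all)
  qed
  moreover have "T c = d_rep c Z q" using c by (simp add: T_def N.charts_at_iff)
  ultimately have "T \<in> comp_at q"
    using d_rep_complement(1,2)[OF c assms(2)] by (simp add: complement_iff[OF c] del: slit_chart_map)
  then have "(\<lambda>d. T d + (-1) *\<^sub>R Z q d) \<in> comp_at q"
    using comp_sectionsD(2)[OF assms(2,1)] by (intro complement_add complement_scaleR assms(1))
  moreover have "(\<lambda>d. T d + (-1) *\<^sub>R Z q d) = lie_bracket N \<Gamma> Z q"
  proof
    fix d
    have "Z q d = 0" if "d \<notin> charts_at N q"
      using N.tangent_space_off_chart[OF complementD(1)[OF c comp_sectionsD(2)[OF assms(2,1)]] that] .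
    then show "T d + (-1) *\<^sub>R Z q d = lie_bracket N \<Gamma> Z q d"
      using lie_bracket_liouville[OF _ _ assms(2), of d q]
      by (auto simp: T_def N.charts_at_iff lie_bracket_def simp del: slit_chart_map)
  qed
  ultimately show ?thesis by simp
qed

lemma lie_bracket_mod_liouville:
  assumes "smooth_fun N a" "smooth_fun N b" "Z \<in> comp_sections" "q \<in> points N"
  shows "\<exists>k. lie_bracket N (field_scale a \<Gamma>) (field_add Z (field_scale b \<Gamma>)) q
    = (\<lambda>d. a q *\<^sub>R lie_bracket N \<Gamma> Z q d + k *\<^sub>R \<Gamma> q d)"
proof (intro exI ext)
  fix d
  let ?Y = "field_add Z (field_scale b \<Gamma>)" and ?X = "field_scale a \<Gamma>"
  \<comment> \<open>From [a Gamma, Y] = a [Gamma, Y] - Y(a) Gamma and [Gamma, Z + b Gamma] =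
    [Gamma, Z] + Gamma(b) Gamma. The witness must not depend on the chart d, so it is phrased with
    \<open>field_apply\<close>.\<close>
  let ?k = "a q * field_apply N \<Gamma> b q - field_apply N ?Y a q"
  show "lie_bracket N ?X ?Y q d = a q *\<^sub>R lie_bracket N \<Gamma> Z q d + ?k *\<^sub>R \<Gamma> q d"
  proof (cases "d \<in> charts_at N q")
    case False
    then show ?thesis
      using N.tangent_space_off_chart[OF liouville_tangent[OF assms(4)]] by (simp add: lie_bracket_def)
  next
    case True
    then have d: "d \<in> charts M" "q \<in> ndom d" by (simp_all add: N.charts_at_iff)
    let ?u = "nmap d q" and ?y = "snd q d"
    let ?a = "a \<circ> chart_inv N d" and ?b = "b \<circ> chart_inv N d"
    note Z = comp_sectionsD[OF assms(3)]
    have u: "?u \<in> nimg d" using d by blast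
    have inv: "chart_inv N d ?u = q" using N.chart_inv_map[of d q] d by simp
    have Y: "?Y \<in> vector_fields N"
      by (intro N.vector_fields_add N.vector_fields_scale Z(1) assms liouville_field)
    have da: "(?a has_derivative frechet_derivative ?a (at ?u)) (at ?u)"
      and db: "(?b has_derivative frechet_derivative ?b (at ?u)) (at ?u)"
      using assms(1,2) d u by (auto simp: smooth_fun_def intro!: smooth_on_has_derivative[of "nimg d"] simp del: slit_chart_map)
    have dZ: "(field_rep N d Z has_derivative frechet_derivative (field_rep N d Z) (at ?u)) (at ?u)"
      using N.vector_fieldsD(3)[OF Z(1), of d] d u by (auto intro!: smooth_on_has_derivative[of "nimg d"])
    have dy: "((\<lambda>u. (0, snd u)) has_derivative (\<lambda>v. (0, snd v))) (at ?u)"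
      by (auto intro!: derivative_eq_intros)
    have "((\<lambda>u. ?a u *\<^sub>R (0, snd u)) has_derivative
        (\<lambda>v. ?a ?u *\<^sub>R (0, snd v) + frechet_derivative ?a (at ?u) v *\<^sub>R (0, snd ?u))) (at ?u)"
      by (rule has_derivative_scaleR[OF da dy])
    then have "(field_rep N d ?X has_derivative
        (\<lambda>v. ?a ?u *\<^sub>R (0, snd v) + frechet_derivative ?a (at ?u) v *\<^sub>R (0, snd ?u))) (at ?u)"
      by (rule has_derivative_transform_within_open[OF _ N.open_image[of d] u])
        (use d liouville_rep in \<open>simp_all add: field_rep_def field_scale_def del: slit_chart_map\<close>)
    then have X': "frechet_derivative (field_rep N d ?X) (at ?u) =
        (\<lambda>v. ?a ?u *\<^sub>R (0, snd v) + frechet_derivative ?a (at ?u) v *\<^sub>R (0, snd ?u))"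
      by (rule frechet_derivative_at[symmetric])
    have "((\<lambda>u. field_rep N d Z u + ?b u *\<^sub>R (0, snd u)) has_derivative
        (\<lambda>v. frechet_derivative (field_rep N d Z) (at ?u) v +
          (?b ?u *\<^sub>R (0, snd v) + frechet_derivative ?b (at ?u) v *\<^sub>R (0, snd ?u)))) (at ?u)"
      by (rule has_derivative_add[OF dZ has_derivative_scaleR[OF db dy]])
    then have "(field_rep N d ?Y has_derivative
        (\<lambda>v. frechet_derivative (field_rep N d Z) (at ?u) v +
          (?b ?u *\<^sub>R (0, snd v) + frechet_derivative ?b (at ?u) v *\<^sub>R (0, snd ?u)))) (at ?u)"
      by (rule has_derivative_transform_within_open[OF _ N.open_image[of d] u])
        (use d liouville_rep in \<open>simp_all add: field_rep_def field_scale_def field_add_def del: slit_chart_map\<close>)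
    then have Y': "frechet_derivative (field_rep N d ?Y) (at ?u) =
        (\<lambda>v. frechet_derivative (field_rep N d Z) (at ?u) v +
          (?b ?u *\<^sub>R (0, snd v) + frechet_derivative ?b (at ?u) v *\<^sub>R (0, snd ?u)))"
      by (rule frechet_derivative_at[symmetric])
    have lin: "frechet_derivative (field_rep N d Z) (at ?u) (a q *\<^sub>R (0, ?y)) = a q *\<^sub>R d_rep d Z q"
      "frechet_derivative ?b (at ?u) (a q *\<^sub>R (0, ?y)) = a q * frechet_derivative ?b (at ?u) (0, ?y)"
      using linear_cmul[OF has_derivative_linear[OF dZ]] linear_cmul[OF has_derivative_linear[OF db]]
      by (simp_all del: slit_chart_map scaleR_Pair)
    have kb: "field_apply N \<Gamma> b q = frechet_derivative ?b (at ?u) (0, ?y)"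
      using N.field_apply_chart[OF _ d(2), of \<Gamma> b] d liouville_tangent assms(2,4)
      by (simp add: liouville_apply[OF assms(4)] del: slit_chart_map)
    have ka: "field_apply N ?Y a q = frechet_derivative ?a (at ?u) (?Y q d)"
      using N.field_apply_chart[OF _ d(2), of ?Y a] d N.vector_fieldsD(2)[OF Y assms(4)] assms(1)
      by (simp del: slit_chart_map)
    have Xq: "?X q d = a q *\<^sub>R (0, ?y)" and Yq: "?Y q d = Z q d + b q *\<^sub>R (0, ?y)"
      by (simp_all only: field_scale_def field_add_def liouville_apply[OF assms(4)])
    have Zq: "Z q d = (0, snd (Z q d))"
      using complementD(2)[OF d Z(2)[OF assms(4)]] by (simp add: prod_eq_iff)
    \<comment> \<open>The two terms with a b (0, y) cancel, which reflects [Gamma, Gamma] =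
      0.\<close>
    have "lie_bracket N ?X ?Y q d = (a q *\<^sub>R d_rep d Z q +
        (b q *\<^sub>R (0, a q *\<^sub>R ?y) + (a q * field_apply N \<Gamma> b q) *\<^sub>R (0, ?y)))
        - (a q *\<^sub>R (0, snd (Z q d) + b q *\<^sub>R ?y) + field_apply N ?Y a q *\<^sub>R (0, ?y))"
      using True unfolding lie_bracket_def if_P[OF True] X' Y' ka kb
      by (simp only: Xq lin comp_apply inv) (simp add: Yq)
    also have "\<dots> = a q *\<^sub>R (d_rep d Z q - (0, snd (Z q d))) + ?k *\<^sub>R (0, ?y)"
      by (simp add: prod_eq_iff algebra_simps del: slit_chart_map)
    finally show ?thesis
      unfolding lie_bracket_liouville[OF d assms(3)] liouville_apply[OF assms(4)] Zq[symmetric] .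
  qed
qed

text \<open>One direction tests X = Gamma and Z' = Z, where the projection acts trivially since Z
  and [Gamma, Z] lie in L'. In the other, the factor a is absorbed by linearity of D in its first
  argument, and the projection discards the multiples of Gamma.\<close>

lemma basic_connection_iff:
  assumes "connection_on N comp_at D"
  shows "basic_connection M F D \<longleftrightarrow> (\<forall>Z\<in>comp_sections. \<forall>q\<in>points N. D \<Gamma> Z q = lie_bracket N \<Gamma> Z q)"
proof
  assume basic: "basic_connection M F D"
  show "\<forall>Z\<in>comp_sections. \<forall>q\<in>points N. D \<Gamma> Z q = lie_bracket N \<Gamma> Z q"
  proof (intro ballI)
    fix Z q assume Z: "Z \<in> comp_sections" and q: "q \<in> points N"
    have "\<Gamma> r \<in> liouville_line M r" for r
      unfolding liouville_line_def by (intro CollectI exI[of _ 1]) simp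
    then have "\<Gamma> \<in> bundle_sections N (liouville_line M)"
      using liouville_field by (simp add: bundle_sections_def)
    moreover have "Z \<in> bundle_sections N (vertical_space M)"
      using Z complement_vertical by (auto simp: bundle_sections_def)
    ultimately have "D \<Gamma> Z q = proj_complement M F q (lie_bracket N \<Gamma> Z q)"
      using basic Z q proj_complement_self comp_sectionsD(2)[OF Z]
      unfolding basic_connection_def Let_def by blast
    then show "D \<Gamma> Z q = lie_bracket N \<Gamma> Z q"
      using proj_complement_self[OF q lie_bracket_liouville_complement[OF q Z]] by simp
  qed
next
  assume bracket: "\<forall>Z\<in>comp_sections. \<forall>q\<in>points N. D \<Gamma> Z q = lie_bracket N \<Gamma> Z q"
  show "basic_connection M F D"
    unfolding basic_connection_def Let_def
  proof (intro ballI impI)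
    fix X Z Y q
    assume X: "X \<in> bundle_sections N (liouville_line M)" and Z: "Z \<in> comp_sections"
      and Y: "Y \<in> bundle_sections N (vertical_space M)"
      and proj: "\<forall>q\<in>points N. proj_complement M F q (Y q) = Z q" and q: "q \<in> points N"
    obtain a where a: "smooth_fun N a" "X = field_scale a \<Gamma>"
    proof (rule liouville_multiple_field)
      show "X \<in> vector_fields N" using X by (simp add: bundle_sections_def)
      show "\<exists>a. X r = (\<lambda>d. a *\<^sub>R \<Gamma> r d)" if "r \<in> points N" for r
        using X that by (auto simp: bundle_sections_def liouville_line_def)
    qed
    \<comment> \<open>Y - Z takes values in the Liouville line, because Z is the projection of
      Y.\<close>
    let ?V = "field_add Y (field_scale (\<lambda>_. -1) Z)"
    obtain b where b: "smooth_fun N b" "?V = field_scale b \<Gamma>"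
    proof (rule liouville_multiple_field)
      show "?V \<in> vector_fields N"
        using Y comp_sectionsD(1)[OF Z]
        by (intro N.vector_fields_add N.vector_fields_scale N.smooth_fun_const) (auto simp: bundle_sections_def)
      show "\<exists>a. ?V r = (\<lambda>d. a *\<^sub>R \<Gamma> r d)" if "r \<in> points N" for r
      proof -
        have "Y r \<in> vertical_space M r" using Y that by (simp add: bundle_sections_def)
        from vertical_decomposition[OF that this] proj that
        obtain a where "Y r = (\<lambda>d. Z r d + a *\<^sub>R \<Gamma> r d)" by auto
        then show ?thesis by (intro exI[of _ a]) (simp add: field_add_def field_scale_def)
      qed
    qed
    have "Y r d = field_add Z (field_scale b \<Gamma>) r d" for r d
      unfolding b(2)[symmetric] by (simp add: field_add_def field_scale_def)
    then have Yeq: "Y = field_add Z (field_scale b \<Gamma>)" by blast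
    obtain k where k: "lie_bracket N X Y q = (\<lambda>d. a q *\<^sub>R lie_bracket N \<Gamma> Z q d + k *\<^sub>R \<Gamma> q d)"
      using lie_bracket_mod_liouville[OF a(1) b(1) Z q] unfolding a(2) Yeq by blast
    have "D X Z q = (\<lambda>d. a q *\<^sub>R lie_bracket N \<Gamma> Z q d)"
      using assms Z a(1) liouville_field bracket q unfolding connection_on_def a(2)
      by (simp add: field_scale_def)
    also have "\<dots> = proj_complement M F q (lie_bracket N X Y q)"
      unfolding k
      using proj_complement_eq[OF q complement_scaleR[OF q lie_bracket_liouville_complement[OF q Z]]] by simp
    finally show "D X Z q = proj_complement M F q (lie_bracket N X Y q)" .
  qed
qed

end

section \<open>The local frame of the complement\<close>

context finsler
begin

text \<open>The function t_k in coordinates, in the form (1/F) dF/dy^k provided by Euler's theorem;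
  its smoothness is visible in this form.\<close>

definition t_rep :: "'i \<Rightarrow> 'n \<Rightarrow> (real^'n) \<times> (real^'n) \<Rightarrow> real" where
  "t_rep c k u = partial_y k (F2 c) u / (2 * F2 c u)"

lemma t_coeff_eq:
  assumes "c \<in> charts M" "q \<in> ndom c"
  shows "t_coeff M F c k q = t_rep c k (nmap c q)"
proof -
  have "t_coeff M F c k q =
      1 / (F q)\<^sup>2 * (\<Sum>i\<in>UNIV. snd (nmap c q) $ i * fundamental_tensor M F c (nmap c q) $ k $ i)"
    by (simp add: t_coeff_def)
  also have "\<dots> = 1 / (F q)\<^sup>2 * (1/2 * partial_y k (F2 c) (nmap c q))"
    using assms by (subst fundamental_tensor_euler) auto
  finally show ?thesis unfolding t_rep_def F2_nmap[OF assms] by simp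
qed

lemma smooth_on_t_rep: "c \<in> charts M \<Longrightarrow> smooth_on (nimg c) (t_rep c k)"
  unfolding t_rep_def[abs_def] using N.open_image[of c] F2_positive
  by (intro smooth_on_divide smooth_on_mult smooth_on_const smooth_on_partial_y_F2 smooth_on_F2)
    (auto simp: less_le simp del: slit_chart_map)

lemma dbar_eq: "dbar_y M F c k q = (\<lambda>d. tangent_of N c q (0, axis k 1) d + (- t_coeff M F c k q) *\<^sub>R \<Gamma> q d)"
  by (simp add: dbar_y_def)

lemma dbar_chart:
  assumes "c \<in> charts M" "q \<in> ndom c"
  shows "dbar_y M F c k q c = (0, axis k 1 - t_rep c k (nmap c q) *\<^sub>R snd q c)"
  using N.tangent_of_self[of c q] assms t_coeff_eq[OF assms]
  by (simp add: dbar_y_def liouville_apply[OF slit_mem_points[OF assms]] del: slit_chart_map)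

text \<open>t_k is exactly the factor for which d_k F^2 - t_k dF^2(Gamma) = d_k F^2 - 2 t_k F^2
  vanishes.\<close>

lemma dbar_complement:
  assumes "c \<in> charts M" "q \<in> ndom c"
  shows "dbar_y M F c k q \<in> comp_at q"
proof -
  have u: "nmap c q \<in> nimg c" using assms by blast
  note lin = dF2_linear[OF assms(1) u]
  have "dbar_y M F c k q \<in> tangent_space N q"
    unfolding dbar_eq using assms liouville_tangent[OF slit_mem_points[OF assms]]
    by (intro N.tangent_space_add N.tangent_space_scaleR N.tangent_of_mem) simp_all
  moreover have eq: "(0, axis k 1 - t_rep c k (nmap c q) *\<^sub>R snd q c)
      = (0, axis k 1) - t_rep c k (nmap c q) *\<^sub>R (0, snd (nmap c q))"
    by simp
  have "dF2 c (nmap c q) (dbar_y M F c k q c) = 0"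
    using F2_positive[OF assms(1) u]
    unfolding dbar_chart[OF assms] eq
    by (simp add: linear_diff[OF lin] linear_cmul[OF lin] euler_F2[OF assms(1) u] t_rep_def partial_y_def
        del: slit_chart_map scaleR_Pair diff_Pair)
  ultimately show ?thesis using complement_iff[OF assms] dbar_chart[OF assms] by simp
qed

lemma complement_zero:
  assumes "q \<in> points N"
  shows "(\<lambda>_. 0) \<in> comp_at q"
proof -
  obtain c where c: "c \<in> charts M" "q \<in> ndom c" using slit_points_chart assms by blast
  from complement_scaleR[OF assms dbar_complement[OF c], of 0] show ?thesis by simp
qed

text \<open>With z^i the components of X on the coordinate fields, replacing these by the local
  frame changes the sum by z^i t_i Gamma, and z^i t_i = dF^2(X) / (2 F^2) = 0.\<close>

lemma complement_expansion:
  assumes "c \<in> charts M" "q \<in> ndom c" "X \<in> comp_at q"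
  shows "X = (\<lambda>d. \<Sum>i\<in>UNIV. snd (X c) $ i *\<^sub>R dbar_y M F c i q d)"
proof (rule N.tangent_space_eqI[OF complementD(1)[OF assms] N.tangent_space_sum])
  have u: "nmap c q \<in> nimg c" using assms by blast
  let ?z = "snd (X c)" and ?y = "snd q c"
  have X: "X c = (0, ?z)" using complementD(2)[OF assms] by (simp add: prod_eq_iff)
  have "(\<Sum>i\<in>UNIV. ?z $ i * t_rep c i (nmap c q)) = dF2 c (nmap c q) (0, ?z) / (2 * F2 c (nmap c q))"
    unfolding dF2_vertical[OF assms(1) u] t_rep_def by (simp add: sum_divide_distrib)
  then have t: "(\<Sum>i\<in>UNIV. ?z $ i * t_rep c i (nmap c q)) = 0"
    using complementD(3)[OF assms] X by simp
  have "(\<Sum>i\<in>UNIV. ?z $ i *\<^sub>R (axis i 1 - t_rep c i (nmap c q) *\<^sub>R ?y))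
      = (\<Sum>i\<in>UNIV. ?z $ i *\<^sub>R axis i 1) - (\<Sum>i\<in>UNIV. ?z $ i * t_rep c i (nmap c q)) *\<^sub>R ?y"
    by (simp add: scaleR_diff_right sum_subtractf scaleR_sum_left del: slit_chart_map)
  also have "\<dots> = ?z"
    unfolding t using basis_expansion[of ?z] by (simp add: scalar_mult_eq_scaleR)
  finally show "X c = (\<Sum>i\<in>UNIV. ?z $ i *\<^sub>R dbar_y M F c i q c)"
    by (subst X) (simp add: dbar_chart[OF assms(1,2)] prod_eq_iff fst_sum snd_sum del: slit_chart_map)
qed (use assms complementD(1)[OF assms(1,2) dbar_complement[OF assms(1,2)]] in simp_all)

text \<open>The bracket depends only on the germ of Z at q, so the chart formula of the local field
  may be differentiated in place of Z.\<close>

lemma lie_bracket_dbar: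
  assumes "c \<in> charts M" "q \<in> ndom c" "Z \<in> comp_sections"
    and "openin (atlas_topology N) W" "q \<in> W" "\<And>r. r \<in> W \<Longrightarrow> Z r = dbar_y M F c i r"
  shows "lie_bracket N \<Gamma> Z q = (\<lambda>d. - dbar_y M F c i q d)"
proof -
  have q: "q \<in> points N" using slit_mem_points assms by blast
  let ?u = "nmap c q" and ?S = "nmap c ` (W \<inter> ndom c)"
  have S: "open ?S" using N.open_chart_image[OF assms(4), of c] assms(1) by simp
  have u: "?u \<in> ?S" "?u \<in> nimg c" using assms by blast+
  let ?dt = "frechet_derivative (t_rep c i) (at ?u)"
  have "((\<lambda>v. (0, axis i 1 - t_rep c i v *\<^sub>R snd v)) has_derivative
      (\<lambda>v. (0, 0 - (t_rep c i ?u *\<^sub>R snd v + ?dt v *\<^sub>R snd ?u)))) (at ?u)"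
    by (intro has_derivative_Pair has_derivative_diff has_derivative_const has_derivative_scaleR
        has_derivative_snd has_derivative_ident smooth_on_has_derivative[OF smooth_on_t_rep[OF assms(1)] u(2)])
  then have "(field_rep N c Z has_derivative (\<lambda>v. (0, 0 - (t_rep c i ?u *\<^sub>R snd v + ?dt v *\<^sub>R snd ?u)))) (at ?u)"
  proof (rule has_derivative_transform_within_open[OF _ S u(1)])
    fix v assume "v \<in> ?S"
    then obtain r where r: "r \<in> W" "r \<in> ndom c" "v = nmap c r" by blast
    then show "(0, axis i 1 - t_rep c i v *\<^sub>R snd v) = field_rep N c Z v"
      using N.chart_inv_map[of c r] assms(1,6) dbar_chart[OF assms(1) r(2), of i]
      by (simp add: field_rep_def)
  qed
  then have "frechet_derivative (field_rep N c Z) (at ?u)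
      = (\<lambda>v. (0, 0 - (t_rep c i ?u *\<^sub>R snd v + ?dt v *\<^sub>R snd ?u)))"
    by (rule frechet_derivative_at[symmetric])
  \<comment> \<open>The coefficient is 0 because t_i is homogeneous of degree -1 in y. This is not
    computed: membership in L' forces it below.\<close>
  then have "d_rep c Z q = (- t_rep c i ?u - ?dt (0, snd q c)) *\<^sub>R \<Gamma> q c"
    by (simp add: liouville_apply[OF q] algebra_simps)
  then have eq: "lie_bracket N \<Gamma> Z q c + dbar_y M F c i q c = (- t_rep c i ?u - ?dt (0, snd q c)) *\<^sub>R \<Gamma> q c"
    using lie_bracket_liouville[OF assms(1-3)] assms(5,6) by simp
  have "(\<lambda>d. lie_bracket N \<Gamma> Z q d + dbar_y M F c i q d) \<in> comp_at q"
    by (intro complement_add q lie_bracket_liouville_complement assms(3) dbar_complement[OF assms(1,2)])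
  from fun_cong[OF complement_liouville_multiple[OF assms(1,2) this eq]]
  show ?thesis by (simp add: fun_eq_iff eq_neg_iff_add_eq_0)
qed

text \<open>Makes the choice inside \<open>local_derivative\<close> meaningful. The cut-off field
  stays in L' everywhere, since its values are multiples of the local field or zero.\<close>

lemma dbar_section_exists:
  assumes "c \<in> charts M" "q \<in> ndom c"
  shows "\<exists>Z. Z \<in> comp_sections \<and>
    (\<exists>W. openin (atlas_topology N) W \<and> q \<in> W \<and> (\<forall>r\<in>W. Z r = dbar_y M F c i r))"
proof -
  have u: "nmap c q \<in> nimg c" and op: "open (nimg c)" using assms N.open_image[of c] by auto
  obtain h K V where h: "smooth_on UNIV h" "compact K" "K \<subseteq> nimg c" "\<And>x. x \<notin> K \<Longrightarrow> h x = (0::real)"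
    "open V" "nmap c q \<in> V" "V \<subseteq> K" "\<And>x. x \<in> V \<Longrightarrow> h x = 1"
    using smooth_bump_exists[OF op u] by metis
  define w where "w v = h v *\<^sub>R (0 :: real^'n, axis i 1 - t_rep c i v *\<^sub>R snd v)" for v
  let ?Z = "N.extend_field c w"
  have "smooth_on (nimg c) w"
    unfolding w_def[abs_def]
    by (intro smooth_on_scaleR smooth_on_Pair smooth_on_const smooth_on_diff smooth_on_snd smooth_on_ident
        smooth_on_t_rep assms(1) op smooth_on_subset[OF h(1)]) auto
  then have field: "?Z \<in> vector_fields N"
    using assms(1) h by (intro N.vector_fields_extend_field[of c K]) (auto simp: w_def zero_prod_def simp del: slit_chart_map)
  have eq: "?Z r = (\<lambda>d. h (nmap c r) *\<^sub>R dbar_y M F c i r d)" if r: "r \<in> ndom c" for r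
  proof (rule N.tangent_space_eqI)
    show "?Z r \<in> tangent_space N r" "(\<lambda>d. h (nmap c r) *\<^sub>R dbar_y M F c i r d) \<in> tangent_space N r"
      using N.vector_fieldsD(2)[OF field slit_mem_points[OF assms(1) r]]
        N.tangent_space_scaleR[OF complementD(1)[OF assms(1) r dbar_complement[OF assms(1) r]]] by blast+
    show "?Z r c = h (nmap c r) *\<^sub>R dbar_y M F c i r c"
      using r N.tangent_of_self[of c r] assms(1) dbar_chart[OF assms(1) r]
      by (simp add: N.extend_field_def w_def)
  qed (use assms r in auto)
  have "?Z r \<in> comp_at r" if "r \<in> points N" for r
    using eq[of r] complement_scaleR[OF that dbar_complement[OF assms(1)]] complement_zero[OF that]
    by (cases "r \<in> ndom c") (simp_all add: N.extend_field_def)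
  then have "?Z \<in> comp_sections" using field by (simp add: bundle_sections_def)
  moreover have "\<forall>r\<in>ndom c \<inter> nmap c -` V. ?Z r = dbar_y M F c i r"
    using eq h(8) by (simp del: slit_chart_map)
  moreover have "openin (atlas_topology N) (ndom c \<inter> nmap c -` V)"
    using openin_chart_preimage[of c N V] assms(1) h(5) by simp
  ultimately show ?thesis using assms(2) h(6) by blast
qed

text \<open>Near q, Z is a combination of the B i. Multiplied by a bump function this becomes a
  global identity, to which D applies; evaluating both sides at q needs D on the B i at that point
  only.\<close>

lemma connection_eq_lie_bracket:
  assumes conn: "connection_on N comp_at D" and c: "c \<in> charts M" "q \<in> ndom c" and Z: "Z \<in> comp_sections"
    and frame: "\<And>i. B i \<in> comp_sections" "\<And>i. openin (atlas_topology N) (W i)" "\<And>i. q \<in> W i"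
      "\<And>i r. r \<in> W i \<Longrightarrow> B i r = dbar_y M F c i r"
    and D: "\<And>i. D \<Gamma> (B i) q = (\<lambda>d. - dbar_y M F c i q d)"
  shows "D \<Gamma> Z q = lie_bracket N \<Gamma> Z q"
proof -
  have q: "q \<in> points N" using slit_mem_points c by blast
  \<comment> \<open>The coordinate region on which every B i coincides with the local frame; open
    because the index set is finite.\<close>
  define U where "U = (\<Inter>i\<in>UNIV. nmap c ` (W i \<inter> ndom c))"
  have "open U" unfolding U_def using N.open_chart_image[OF frame(2)] c by (intro open_INT) simp_all
  moreover have "nmap c q \<in> U" unfolding U_def using frame(3) c(2) by blast
  ultimately obtain h K V where h: "smooth_on UNIV h" "compact K" "K \<subseteq> U" "\<And>x. x \<notin> K \<Longrightarrow> h x = (0::real)"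
    "open V" "nmap c q \<in> V" "V \<subseteq> K" "\<And>x. x \<in> V \<Longrightarrow> h x = 1"
    using smooth_bump_exists by metis
  have U: "U \<subseteq> nimg c" unfolding U_def by blast
  have op: "open (nimg c)" using N.open_image c by simp
  have hs: "smooth_on (nimg c) h" by (rule smooth_on_subset[OF h(1)]) simp
  define z where "z i v = snd (field_rep N c Z v) $ i" for i v
  define a where "a i = N.extend_fun c (\<lambda>v. h v * z i v)" for i
  define b where "b = N.extend_fun c h"
  have rep: "smooth_on (nimg c) (field_rep N c Z)"
    using N.vector_fieldsD(3)[OF comp_sectionsD(1)[OF Z]] c by simp
  have zs: "smooth_on (nimg c) (z i)" for i
    unfolding z_def[abs_def] using rep
    by (intro smooth_on_bounded_linear[OF op bounded_linear_vec_nth] smooth_on_snd op)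
  have as: "smooth_fun N (a i)" for i
    unfolding a_def using c h U by (intro N.smooth_fun_extend_fun[of c K] smooth_on_mult op hs zs) auto
  have bs: "smooth_fun N b"
    unfolding b_def using c h U by (intro N.smooth_fun_extend_fun[of c K] hs) auto
  have V: "v \<in> nimg c" "chart_inv N c v \<in> ndom c" "nmap c (chart_inv N c v) = v" if "v \<in> V" for v
  proof -
    show v: "v \<in> nimg c" using that h(3,7) U by blast
    show "chart_inv N c v \<in> ndom c" "nmap c (chart_inv N c v) = v"
      using N.chart_inv_mem[OF v] N.chart_map_inv[OF v] by auto
  qed
  \<comment> \<open>Derivatives at q see only V, where the bump function is 1, so it leaves no trace
    in Gamma(a i) and Gamma(b).\<close>
  have germ: "field_apply N \<Gamma> f q = frechet_derivative g (at (nmap c q)) (0, snd q c)"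
    if f: "smooth_fun N f" "\<And>v. v \<in> V \<Longrightarrow> (f \<circ> chart_inv N c) v = g v" for f g
  proof -
    have "f \<circ> chart_inv N c differentiable at (nmap c q)"
      using f(1) c by (auto simp: smooth_fun_def intro!: smooth_on_differentiable[of "nimg c"])
    then have "frechet_derivative (f \<circ> chart_inv N c) (at (nmap c q)) = frechet_derivative g (at (nmap c q))"
      by (rule frechet_derivative_transform_within_open[OF _ h(5,6)]) (rule f(2))
    moreover have "field_apply N \<Gamma> f q = frechet_derivative (f \<circ> chart_inv N c) (at (nmap c q)) (\<Gamma> q c)"
      by (rule N.field_apply_chart) (use c f(1) liouville_tangent[OF q] in simp_all)
    ultimately show ?thesis by (simp only: liouville_apply[OF q])
  qed
  have a': "field_apply N \<Gamma> (a i) q = snd (d_rep c Z q) $ i" for i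
  proof -
    have "field_apply N \<Gamma> (a i) q = frechet_derivative (z i) (at (nmap c q)) (0, snd q c)"
      by (rule germ[OF as]) (use V h(8) in \<open>simp add: a_def N.extend_fun_def del: slit_chart_map\<close>)
    moreover have "(z i has_derivative (\<lambda>v. snd (frechet_derivative (field_rep N c Z) (at (nmap c q)) v) $ i)) (at (nmap c q))"
      unfolding z_def[abs_def] using smooth_on_has_derivative[OF rep] c(2)
      by (intro bounded_linear.has_derivative[OF bounded_linear_vec_nth] has_derivative_snd) blast
    ultimately show ?thesis using frechet_derivative_at by metis
  qed
  have b': "field_apply N \<Gamma> b q = 0"
  proof -
    have "field_apply N \<Gamma> b q = frechet_derivative (\<lambda>_. 1) (at (nmap c q)) (0, snd q c)"
      by (rule germ[OF bs]) (use V h(8) in \<open>simp add: b_def N.extend_fun_def del: slit_chart_map\<close>)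
    then show ?thesis by simp
  qed
  \<comment> \<open>Both sides vanish off K. Over K all B i agree with the local frame, and the
    identity is the expansion of Z times h.\<close>
  have eq: "field_scale b Z = (\<lambda>r d. \<Sum>i\<in>UNIV. a i r *\<^sub>R B i r d)"
  proof (intro ext)
    fix r d
    show "field_scale b Z r d = (\<Sum>i\<in>UNIV. a i r *\<^sub>R B i r d)"
    proof (cases "r \<in> ndom c \<and> nmap c r \<in> K")
      case False
      then have "b r = 0" "a i r = 0" for i using h(4) by (auto simp: a_def b_def N.extend_fun_def)
      then show ?thesis by (simp add: field_scale_def)
    next
      case True
      have "r \<in> W i" for i
      proof -
        have "nmap c r \<in> nmap c ` (W i \<inter> ndom c)" using True h(3) unfolding U_def by blast
        then show ?thesis using True inj_onD[OF slit_inj[OF c(1)]] by blast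
      qed
      then have "a i r *\<^sub>R B i r d = h (nmap c r) *\<^sub>R (snd (Z r c) $ i *\<^sub>R dbar_y M F c i r d)" for i
        using True frame(4) N.chart_inv_map[of c r] c(1)
        by (simp add: a_def z_def N.extend_fun_def field_rep_def)
      then have "(\<Sum>i\<in>UNIV. a i r *\<^sub>R B i r d)
          = h (nmap c r) *\<^sub>R (\<Sum>i\<in>UNIV. snd (Z r c) $ i *\<^sub>R dbar_y M F c i r d)"
        by (simp only: scaleR_sum_right)
      also have "\<dots> = h (nmap c r) *\<^sub>R Z r d"
        using fun_cong[OF complement_expansion[OF c(1) _ comp_sectionsD(2)[OF Z], of r], of d]
          True slit_mem_points[OF c(1), of r] by (simp only:)
      finally show ?thesis using True by (simp add: field_scale_def b_def N.extend_fun_def)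
    qed
  qed
  have Db: "D \<Gamma> (field_scale b Z) = field_add (field_scale (field_apply N \<Gamma> b) Z) (field_scale b (D \<Gamma> Z))"
    using conn Z bs liouville_field unfolding connection_on_def by blast
  have Dsum: "D \<Gamma> (\<lambda>r d. \<Sum>i\<in>UNIV. a i r *\<^sub>R B i r d) =
      (\<lambda>r d. \<Sum>i\<in>UNIV. field_apply N \<Gamma> (a i) r *\<^sub>R B i r d + a i r *\<^sub>R D \<Gamma> (B i) r d)"
    by (rule conjunct2[OF N.connection_on_sum[OF conn liouville_field]])
      (simp_all add: as frame(1) complement_zero complement_add complement_scaleR)
  \<comment> \<open>The Leibniz rule on both sides of the identity, at q. On the left only D Z
    remains, as b = 1 and Gamma(b) = 0 there.\<close>
  have "field_add (field_scale (field_apply N \<Gamma> b) Z) (field_scale b (D \<Gamma> Z)) q d =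
      (\<Sum>i\<in>UNIV. field_apply N \<Gamma> (a i) q *\<^sub>R B i q d + a i q *\<^sub>R D \<Gamma> (B i) q d)" for d
    unfolding Db[symmetric] eq Dsum ..
  moreover have bq: "b q = 1" and aq: "a i q = snd (Z q c) $ i" for i
    using c h(6,8) N.chart_inv_map[of c q] by (simp_all add: a_def b_def z_def N.extend_fun_def field_rep_def)
  ultimately have "D \<Gamma> Z q d = (\<Sum>i\<in>UNIV. snd (d_rep c Z q) $ i *\<^sub>R dbar_y M F c i q d
      + snd (Z q c) $ i *\<^sub>R - dbar_y M F c i q d)" for d
    by (simp only: field_add_def field_scale_def a' b' aq bq D frame(4)[OF frame(3)]
        scaleR_zero_left scaleR_one add_0)
  \<comment> \<open>Gamma(z^i) - z^i is the i-th vertical component of [Gamma, Z], so the sum is the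
    frame expansion of the bracket.\<close>
  then have exp: "D \<Gamma> Z q d = (\<Sum>i\<in>UNIV. snd (lie_bracket N \<Gamma> Z q c) $ i *\<^sub>R dbar_y M F c i q d)" for d
    unfolding lie_bracket_liouville[OF c Z]
    by (simp only: snd_diff vector_minus_component scaleR_diff_left scaleR_minus_right add_uminus_conv_diff)
  show ?thesis
    by (rule trans[OF ext[OF exp] complement_expansion[OF c lie_bracket_liouville_complement[OF q Z], symmetric]])
qed

lemma basic_connection_iff_local_derivative:
  assumes conn: "connection_on N comp_at D"
  shows "basic_connection M F D \<longleftrightarrow>
    (\<forall>c\<in>charts M. \<forall>i. \<forall>q\<in>ndom c.
       local_derivative N comp_at D \<Gamma> (dbar_y M F c i) q = (\<lambda>d. - dbar_y M F c i q d))"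
    (is "_ \<longleftrightarrow> ?local")
proof -
  \<comment> \<open>The very section chosen inside \<open>local_derivative\<close>. Only its two
    defining properties enter, so the choice is immaterial.\<close>
  define B where "B c i q = (SOME Z. Z \<in> comp_sections \<and>
    (\<exists>W. openin (atlas_topology N) W \<and> q \<in> W \<and> (\<forall>r\<in>W. Z r = dbar_y M F c i r)))" for c i q
  have B: "B c i q \<in> comp_sections"
    "\<exists>W. openin (atlas_topology N) W \<and> q \<in> W \<and> (\<forall>r\<in>W. B c i q r = dbar_y M F c i r)"
    if "c \<in> charts M" "q \<in> ndom c" for c i q
    using someI_ex[OF dbar_section_exists[OF that]] unfolding B_def by blast+
  have loc: "local_derivative N comp_at D \<Gamma> (dbar_y M F c i) q = D \<Gamma> (B c i q) q" for c i q
    by (simp add: local_derivative_def B_def)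
  have "?local \<longleftrightarrow> (\<forall>Z\<in>comp_sections. \<forall>q\<in>points N. D \<Gamma> Z q = lie_bracket N \<Gamma> Z q)"
  proof
    assume l: ?local
    show "\<forall>Z\<in>comp_sections. \<forall>q\<in>points N. D \<Gamma> Z q = lie_bracket N \<Gamma> Z q"
    proof (intro ballI)
      fix Z q assume Z: "Z \<in> comp_sections" and "q \<in> points N"
      then obtain c where c: "c \<in> charts M" "q \<in> ndom c" using slit_points_chart by blast
      obtain W where "\<And>i. openin (atlas_topology N) (W i)" "\<And>i. q \<in> W i"
        "\<And>i r. r \<in> W i \<Longrightarrow> B c i q r = dbar_y M F c i r"
        using B(2)[OF c] by metis
      then show "D \<Gamma> Z q = lie_bracket N \<Gamma> Z q"
        using l c by (intro connection_eq_lie_bracket[OF conn c Z B(1)[OF c], where W = W]) (auto simp: loc[symmetric])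
    qed
  next
    assume bracket: "\<forall>Z\<in>comp_sections. \<forall>q\<in>points N. D \<Gamma> Z q = lie_bracket N \<Gamma> Z q"
    show ?local
      unfolding loc
    proof (intro ballI allI)
      fix c i q assume c: "c \<in> charts M" "q \<in> ndom c"
      obtain W where W: "openin (atlas_topology N) W" "q \<in> W" "\<And>r. r \<in> W \<Longrightarrow> B c i q r = dbar_y M F c i r"
        using B(2)[OF c, of i] by metis
      show "D \<Gamma> (B c i q) q = (\<lambda>d. - dbar_y M F c i q d)"
        using trans[OF bracket[rule_format, OF B(1)[OF c] slit_mem_points[OF c]] lie_bracket_dbar[OF c B(1)[OF c] W]] .
    qed
  qed
  then show ?thesis unfolding basic_connection_iff[OF conn] by (rule sym)
qed

end

theorem proposition3p2:
  fixes M :: "('i, 'm, real^'n) atlas"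
    and F :: "'m \<times> ('i \<Rightarrow> real^'n) \<Rightarrow> real"
    and D :: "('m \<times> ('i \<Rightarrow> real^'n) \<Rightarrow> 'i \<Rightarrow> (real^'n) \<times> (real^'n)) \<Rightarrow>
              ('m \<times> ('i \<Rightarrow> real^'n) \<Rightarrow> 'i \<Rightarrow> (real^'n) \<times> (real^'n)) \<Rightarrow>
              ('m \<times> ('i \<Rightarrow> real^'n) \<Rightarrow> 'i \<Rightarrow> (real^'n) \<times> (real^'n))"
  assumes "smooth_manifold M"
    and "finsler_metric M F"
    and "connection_on (slit_tangent_bundle M) (liouville_complement M F) D"
  shows "basic_connection M F D \<longleftrightarrow>
    (\<forall>c\<in>charts M. \<forall>i. \<forall>q\<in>chart_dom (slit_tangent_bundle M) c.
       local_derivative (slit_tangent_bundle M) (liouville_complement M F) D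
         (liouville M) (dbar_y M F c i) q = (\<lambda>d. - dbar_y M F c i q d))"
proof -
  interpret finsler M F
    using smooth_manifold_imp_smooth_atlas[OF assms(1)] assms(2)
    by (simp add: finsler_def finsler_axioms_def)
  show ?thesis by (rule basic_connection_iff_local_derivative[OF assms(3)])
qed

end
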